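(* Let $f$ be a non-negative operator monotone function on $[0,\infty)$ such that $f(0)=0$. Then for any positive semidefinite matrices $A$ and $B$ (of the same size), $$\operatorname{Tr}\big((A-B)(f(A)-f(B))\big) \ \le\ \operatorname{Tr}\big(|A-B|\, f(|A-B|)\big).$$
   Context: Matrices are square complex matrices of an arbitrary finite size $n\times n$; positive semidefinite matrices are Hermitian. $\operatorname{Tr}$ is the usual (unnormalized) trace. For a matrix $X$, $|X| = (X^*X)^{1/2}$. For a positive semidefinite matrix $X$ and a function $f:[0,\infty)\to\mathbb{R}$, $f(X)$ is defined by the functional calculus (spectral theorem). For Hermitian matrices, $X \le Y$ means that $Y-X$ is positive semidefinite. A function $f:[0,\infty)\to\mathbb{R}$ is operator monotone on $[0,\infty)$ if, for every $n$ and all positive semidefinite $n\times n$ matrices $X, Y$, $X\le Y$ implies $f(X)\le f(Y)$. *)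

theory Defs
  imports Jordan_Normal_Form.Spectral_Radius
begin

definition mat_trace :: "complex mat \<Rightarrow> complex" where
  "mat_trace A = (\<Sum>i<dim_row A. A $$ (i, i))"

(* Any solution of this equation is a square matrix. *)
definition hermitian_mat :: "complex mat \<Rightarrow> bool" where
  "hermitian_mat A \<longleftrightarrow> mat_adjoint A = A"

definition unitary_mat :: "nat \<Rightarrow> complex mat \<Rightarrow> bool" where
  "unitary_mat n U \<longleftrightarrow>
     U \<in> carrier_mat n n \<and> mat_adjoint U * U = 1\<^sub>m n \<and> U * mat_adjoint U = 1\<^sub>m n"

(* The inequality is the one of HOL-Library.Complex_Order: the quadratic form is real
   and nonnegative. *)
definition psd_mat :: "complex mat \<Rightarrow> bool" where
  "psd_mat A \<longleftrightarrow>
     hermitian_mat A \<and> (\<forall>v \<in> carrier_vec (dim_row A). 0 \<le> (A *\<^sub>v v) \<bullet>c v)"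

(* The order \<le> already available on the type mat is entrywise, hence a separate relation. *)
definition loewner_le :: "complex mat \<Rightarrow> complex mat \<Rightarrow> bool" where
  "loewner_le X Y \<longleftrightarrow>
     dim_row X = dim_row Y \<and> dim_col X = dim_col Y \<and> psd_mat (Y - X)"

definition spectral_decomp :: "complex mat \<Rightarrow> complex mat \<Rightarrow> (nat \<Rightarrow> real) \<Rightarrow> bool" where
  "spectral_decomp X U d \<longleftrightarrow>
     unitary_mat (dim_row X) U \<and>
     X = U * mat_diag (dim_row X) (\<lambda>i. complex_of_real (d i)) * mat_adjoint U"

(* f(X) = U diag(f(d_0), ..., f(d_(n-1))) U^* whenever X = U diag(d_0, ..., d_(n-1)) U^* with
   U unitary and d real; such a decomposition exists for Hermitian X by the spectral theorem,
   and the result does not depend on it (mat_fun_eq below).  Only the values of f at the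
   eigenvalues of X matter, so for positive semidefinite X only those on [0, oo). *)
definition mat_fun :: "(real \<Rightarrow> real) \<Rightarrow> complex mat \<Rightarrow> complex mat" where
  "mat_fun f X = (THE Y. \<exists>U d. spectral_decomp X U d \<and>
     Y = U * mat_diag (dim_row X) (\<lambda>i. complex_of_real (f (d i))) * mat_adjoint U)"

definition mat_abs :: "complex mat \<Rightarrow> complex mat" where
  "mat_abs X = mat_fun sqrt (mat_adjoint X * X)"

(* A function on [0, oo) is represented by a total function on the reals whose values at
   negative arguments are irrelevant. *)
definition operator_monotone :: "(real \<Rightarrow> real) \<Rightarrow> bool" where
  "operator_monotone f \<longleftrightarrow>
     (\<forall>n. \<forall>X \<in> carrier_mat n n. \<forall>Y \<in> carrier_mat n n.
        psd_mat X \<longrightarrow> psd_mat Y \<longrightarrow> loewner_le X Y \<longrightarrow>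
        loewner_le (mat_fun f X) (mat_fun f Y))"

lemma mat_adjoint_carrier:
  assumes "A \<in> carrier_mat n m"
  shows "mat_adjoint A \<in> carrier_mat m n"
  using assms by (auto simp: mat_adjoint_def)

lemma spectral_decomp_unique:
  assumes "spectral_decomp X U d" and "spectral_decomp X V e"
  shows "U * mat_diag (dim_row X) (\<lambda>i. complex_of_real (f (d i))) * mat_adjoint U =
         V * mat_diag (dim_row X) (\<lambda>i. complex_of_real (f (e i))) * mat_adjoint V"
proof -
  define n where "n = dim_row X"
  define D where "D = (\<lambda>h. mat_diag n (\<lambda>i. complex_of_real (h (d i))))"
  define E where "E = (\<lambda>h. mat_diag n (\<lambda>i. complex_of_real (h (e i))))"
  define U' where "U' = mat_adjoint U"
  define V' where "V' = mat_adjoint V"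
  define W where "W = V' * U"
  have U: "U \<in> carrier_mat n n" "U' \<in> carrier_mat n n" "U' * U = 1\<^sub>m n" "U * U' = 1\<^sub>m n"
   and V: "V \<in> carrier_mat n n" "V' \<in> carrier_mat n n" "V' * V = 1\<^sub>m n" "V * V' = 1\<^sub>m n"
    using assms mat_adjoint_carrier
    unfolding spectral_decomp_def unitary_mat_def n_def U'_def V'_def by auto
  have D [simp]: "D h \<in> carrier_mat n n" and E [simp]: "E h \<in> carrier_mat n n" for h
    by (auto simp: D_def E_def)
  have W: "W \<in> carrier_mat n n" using U V by (auto simp: W_def)
  note [simp] = assoc_mult_mat[of _ n n _ n _ n] mult_carrier_mat[of _ n n _ n]
    left_mult_one_mat[of _ n n] right_mult_one_mat[of _ n n]
  have eq: "U * (D (\<lambda>x. x) * U') = V * (E (\<lambda>x. x) * V')"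
  proof -
    have "U * D (\<lambda>x. x) * U' = V * E (\<lambda>x. x) * V'"
      using assms unfolding spectral_decomp_def D_def E_def n_def U'_def V'_def by metis
    then show ?thesis using U V by simp
  qed
  have "V' * (U * (D (\<lambda>x. x) * U')) * U = V' * (V * (E (\<lambda>x. x) * V')) * U"
    unfolding eq ..
  moreover have "V' * (U * (D (\<lambda>x. x) * U')) * U = W * D (\<lambda>x. x)"
    using U V by (simp add: W_def)
  moreover have "V' * (V * (E (\<lambda>x. x) * V')) * U = (V' * V) * (E (\<lambda>x. x) * W)"
    using U(1,2) V(1,2) by (simp add: W_def)
  ultimately have comm: "W * D (\<lambda>x. x) = E (\<lambda>x. x) * W"
    using V(3) W by simp
  have entry: "W $$ (i, j) * complex_of_real (d j) = complex_of_real (e i) * W $$ (i, j)"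
    if "i < n" "j < n" for i j
    using arg_cong[OF comm, of "\<lambda>M. M $$ (i, j)"] that
    unfolding D_def E_def mat_diag_mult_right[OF W] mat_diag_mult_left[OF W] by simp
  have comm_f: "W * D f = E f * W"
    unfolding D_def E_def mat_diag_mult_right[OF W] mat_diag_mult_left[OF W]
  proof (rule cong_mat)
    fix i j assume "i < n" "j < n"
    from entry[OF this] have "W $$ (i, j) = 0 \<or> d j = e i" by auto
    then show "(case (i, j) of (i, j) \<Rightarrow> W $$ (i, j) * complex_of_real (f (d j))) =
               (case (i, j) of (i, j) \<Rightarrow> complex_of_real (f (e i)) * W $$ (i, j))" by auto
  qed auto
  have "V * (W * D f) * U' = V * (E f * W) * U'" unfolding comm_f ..
  moreover have "V * (W * D f) * U' = (V * V') * (U * D f * U')"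
    using U(1,2) V(1,2) by (simp add: W_def)
  moreover have "V * (E f * W) * U' = V * E f * V' * (U * U')"
    using U(1,2) V(1,2) by (simp add: W_def)
  ultimately have "U * D f * U' = V * E f * V'" using U V by simp
  then show ?thesis by (simp add: D_def E_def U'_def V'_def n_def)
qed

lemma mat_fun_eq:
  assumes "spectral_decomp X U d"
  shows "mat_fun f X =
    U * mat_diag (dim_row X) (\<lambda>i. complex_of_real (f (d i))) * mat_adjoint U"
  unfolding mat_fun_def
  by (rule the_equality) (use assms spectral_decomp_unique[OF _ assms] in blast)+

end

theory Submission
  imports Defs
begin

text \<open>Why the inequality holds. For fixed \<open>A\<close> and \<open>B\<close>, the difference of its two sides is a linear function
of the values of \<open>f\<close> at finitely many points, the eigenvalues of \<open>A\<close>, \<open>B\<close> and \<open>|A - B|\<close>. Two facts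
about such linear expressions suffice.

First, the inequality holds for \<open>f(x) = x / (x + s)\<close> with \<open>s > 0\<close> (\<open>resolvent_difference_bound\<close>). Write
\<open>A - B = P - N\<close> with the positive and negative part and \<open>C = B + P = A + N\<close>. Since \<open>C\<close> dominates both \<open>A\<close>
and \<open>B\<close>, antitonicity of the resolvent decouples the two parts, and it remains to compare \<open>B\<close> with
\<open>B + P\<close>, tested against \<open>P\<close>. There the claim is that passing from 0 to \<open>P\<close> changes the resolvent the
most, and it reduces, by a positivity argument with traces and completing a square, to scalars
(\<open>resolvent_trace_bound\<close>).

Second, a linear inequality between finitely many values which holds for all \<open>x / (x + s)\<close> holds for
every operator monotone function vanishing at 0 (\<open>operator_monotone_resolvent_test\<close>). This is what
Loewner's integral representation would give, but the finite statement has an elementary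
proof along the lines of Sparr's approach to Loewner's theorem. As a function of \<open>s\<close>, the
expression has a numerator which is a polynomial nonnegative on \<open>[0,\<infinity>)\<close>, hence a sum of terms
\<open>q\<^sup>2\<close> and \<open>s * r\<^sup>2\<close> (\<open>poly_nonneg_halfline_sos\<close>). So only the inequalities
\<open>(\<Sum>x\<in>S. f x * v(x)\<^sup>2 / \<omega> x) \<le> 0\<close> with \<open>\<omega> x = (\<Prod>y\<in>S - {x}. y - x)\<close> for polynomials \<open>v\<close> of small degree are
needed (\<open>operator_monotone_nodal\<close>). These come from operator monotonicity, applied to two matrices whose
interlacing spectra are the nodes with \<open>\<omega> x > 0\<close> and with \<open>\<omega> x < 0\<close>, and which differ by a rank one
matrix.\<close>

section \<open>Polynomials nonnegative on the half-line\<close>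

lemma poly_nonneg_right_limit:
  fixes p :: "real poly"
  assumes "\<And>x. a < x \<Longrightarrow> x < b \<Longrightarrow> 0 \<le> poly p x" and "a < b"
  shows "0 \<le> poly p a"
proof (rule tendsto_lowerbound)
  show "(poly p \<longlongrightarrow> poly p a) (at_right a)"
    by (intro tendsto_intros)
  show "\<forall>\<^sub>F x in at_right a. 0 \<le> poly p x"
    using assms unfolding eventually_at_right_field by blast
qed simp

lemma poly_nonpos_left_limit:
  fixes p :: "real poly"
  assumes "\<And>x. b < x \<Longrightarrow> x < a \<Longrightarrow> poly p x \<le> 0" and "b < a"
  shows "poly p a \<le> 0"
proof (rule tendsto_upperbound)
  show "(poly p \<longlongrightarrow> poly p a) (at_left a)"
    by (intro tendsto_intros)
  show "\<forall>\<^sub>F x in at_left a. poly p x \<le> 0"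
    using assms unfolding eventually_at_left_field by blast
qed simp

lemma degree_diff_const:
  fixes p :: "real poly"
  assumes "0 < degree p"
  shows "degree (p - [:c:]) = degree p"
  using degree_add_eq_left[of "- [:c:]" p] assms by (simp only: diff_conv_add_uminus) simp

lemma poly_nonneg_attains_min:
  fixes p :: "real poly"
  assumes nonneg: "\<And>x. 0 \<le> x \<Longrightarrow> 0 \<le> poly p x" and deg: "0 < degree p"
  obtains a where "0 \<le> a" and "\<And>x. 0 \<le> x \<Longrightarrow> poly p a \<le> poly p x"
proof -
  have "lead_coeff p \<noteq> 0" using deg by auto
  moreover have False if neg: "lead_coeff p < 0"
  proof -
    from neg have "0 < lead_coeff (- p)" by simp
    from poly_pinfty_gt_lc[OF this] obtain n where n: "\<And>x. n \<le> x \<Longrightarrow> - lead_coeff p \<le> - poly p x"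
      by auto
    show False using n[of "max n 0"] nonneg[of "max n 0"] neg by auto
  qed
  ultimately have lc: "0 < lead_coeff p" by force
  define q where "q = p - [:poly p 0:]"
  have "degree q = degree p" using degree_diff_const[OF deg] by (simp add: q_def)
  then have "lead_coeff q = lead_coeff p"
    using deg by (simp add: q_def coeff_pCons split: nat.split)
  then have "0 < lead_coeff q" using lc by simp
  from poly_pinfty_gt_lc[OF this] obtain M where M: "\<And>x. M \<le> x \<Longrightarrow> 0 < poly q x"
    using \<open>0 < lead_coeff q\<close> by (metis less_le_trans)
  define m where "m = max M 0"
  have "\<exists>a. 0 \<le> a \<and> a \<le> m \<and> (\<forall>x. 0 \<le> x \<and> x \<le> m \<longrightarrow> poly p a \<le> poly p x)"
    by (rule isCont_eq_Lb[THEN exE, of 0 m "poly p"]) (auto simp: m_def)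
  then obtain a where a: "0 \<le> a" "a \<le> m" "\<And>x. 0 \<le> x \<Longrightarrow> x \<le> m \<Longrightarrow> poly p a \<le> poly p x" by blast
  have "poly p a \<le> poly p x" if "0 \<le> x" for x
  proof (cases "x \<le> m")
    case False
    then have "poly p 0 < poly p x" using M[of x] by (simp add: q_def m_def)
    with a(3)[of 0] show ?thesis by (simp add: m_def)
  qed (use a that in auto)
  with a(1) that show ?thesis by blast
qed

lemma sum_list_mult_squares:
  fixes l :: "'a :: comm_semiring_0"
  shows "(\<Sum>r\<leftarrow>rs. (l * r) * (l * r)) = l * l * (\<Sum>r\<leftarrow>rs. r * r)"
  by (induction rs) (simp_all add: algebra_simps)

text \<open>Induction on the degree. A nonconstant polynomial that is nonnegative on the half-line attains its
minimum \<open>c\<close> there, at some \<open>a\<close>. Then \<open>p - c\<close> vanishes at \<open>a\<close> and is still nonnegative. If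
\<open>a = 0\<close>, the quotient by the variable is nonnegative, and multiplying its decomposition by the
variable exchanges the two kinds of summands. If \<open>a > 0\<close>, the root is double, and multiplying by
\<open>(x - a)\<^sup>2\<close> preserves both kinds. No cancellation of leading terms is involved, which is why the
degree bounds come for free; they are what matches the number of available nodes later on.\<close>

lemma poly_nonneg_halfline_sos:
  fixes p :: "real poly"
  assumes "\<And>x. 0 \<le> x \<Longrightarrow> 0 \<le> poly p x"
  shows "\<exists>qs rs. p = (\<Sum>q\<leftarrow>qs. q * q) + [:0, 1:] * (\<Sum>r\<leftarrow>rs. r * r) \<and>
     (\<forall>q\<in>set qs. 2 * degree q \<le> degree p) \<and> (\<forall>r\<in>set rs. 2 * degree r + 1 \<le> degree p)"
  using assms
proof (induction "degree p" arbitrary: p rule: less_induct)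
  case less
  have const: "[:c:] = [:sqrt c:] * [:sqrt c:]" if "0 \<le> c" for c :: real
    using that by simp
  show ?case
  proof (cases "degree p = 0")
    case True
    then obtain c where c: "p = [:c:]" by (metis degree_eq_zeroE)
    with less.prems[of 0] have "0 \<le> c" by simp
    show ?thesis
      by (rule exI[of _ "[[:sqrt c:]]"], rule exI[of _ "[]"]) (use c const[OF \<open>0 \<le> c\<close>] in simp)
  next
    case False
    then obtain a where a: "0 \<le> a" and amin: "\<And>x. 0 \<le> x \<Longrightarrow> poly p a \<le> poly p x"
      using poly_nonneg_attains_min[OF less.prems] by blast
    define c where "c = poly p a"
    have c0: "0 \<le> c" using less.prems[OF a] by (simp add: c_def)
    have "poly (p - [:c:]) a = 0" by (simp add: c_def)
    then obtain p1 where p1: "p - [:c:] = [:-a, 1:] * p1" by (metis dvdE poly_eq_0_iff_dvd)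
    have degpc: "degree (p - [:c:]) = degree p"
      using False degree_diff_const by blast
    with False have "p1 \<noteq> 0" using p1 by auto
    then have deg1: "degree p = degree p1 + 1"
      using degpc unfolding p1 by (subst (asm) degree_mult_eq) auto
    have p1_eq: "(x - a) * poly p1 x = poly p x - c" for x
      using arg_cong[OF p1, of "\<lambda>q. poly q x"] by (simp add: algebra_simps)
    have p1_sign: "0 \<le> (x - a) * poly p1 x" if "0 \<le> x" for x
      unfolding p1_eq using amin[OF that] by (simp add: c_def)
    have p1_pos: "0 \<le> poly p1 x" if "a < x" for x
      using p1_sign[of x] that a by (simp add: zero_le_mult_iff)
    have p1_neg: "poly p1 x \<le> 0" if "0 \<le> x" "x < a" for x
      using p1_sign[of x] that by (simp add: zero_le_mult_iff)
    have p1_a: "0 \<le> poly p1 a" by (rule poly_nonneg_right_limit[of a "a + 1"]) (use p1_pos in auto)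
    have deg_lin: "2 * degree (l * r) \<le> 2 * degree r + 2" if "degree l = 1" for l r :: "real poly"
      using degree_mult_le[of l r] that by linarith
    show ?thesis
    proof (cases "a = 0")
      case True
      have "\<And>x. 0 \<le> x \<Longrightarrow> 0 \<le> poly p1 x"
        using p1_pos p1_a True by (metis less_eq_real_def)
      then have "\<exists>qs rs. p1 = (\<Sum>q\<leftarrow>qs. q * q) + [:0, 1:] * (\<Sum>r\<leftarrow>rs. r * r) \<and>
          (\<forall>q\<in>set qs. 2 * degree q \<le> degree p1) \<and> (\<forall>r\<in>set rs. 2 * degree r + 1 \<le> degree p1)"
        by (intro less.hyps) (use deg1 in simp_all)
      then obtain qs rs where
        dec: "p1 = (\<Sum>q\<leftarrow>qs. q * q) + [:0, 1:] * (\<Sum>r\<leftarrow>rs. r * r)"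
        and qs: "\<forall>q\<in>set qs. 2 * degree q \<le> degree p1"
        and rs: "\<forall>r\<in>set rs. 2 * degree r + 1 \<le> degree p1" by blast
      have "p = [:c:] + (p - [:c:])" by simp
      also have "\<dots> = [:c:] + [:0, 1:] * p1" unfolding p1 using True by simp
      finally have p_eq: "p = [:c:] + [:0, 1:] * p1" .
      have "p = [:sqrt c:] * [:sqrt c:] + [:0, 1:] * ((\<Sum>q\<leftarrow>qs. q * q) + [:0, 1:] * (\<Sum>r\<leftarrow>rs. r * r))"
        unfolding const[OF c0, symmetric] dec[symmetric] by (rule p_eq)
      also have "\<dots> = (\<Sum>q\<leftarrow>[:sqrt c:] # map (\<lambda>r. [:0, 1:] * r) rs. q * q) + [:0, 1:] * (\<Sum>r\<leftarrow>qs. r * r)"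
        by (simp only: list.map sum_list.Cons map_map o_def sum_list_mult_squares)
          (simp only: distrib_left mult_ac add_ac)
      finally have "p = (\<Sum>q\<leftarrow>[:sqrt c:] # map (\<lambda>r. [:0, 1:] * r) rs. q * q) + [:0, 1:] * (\<Sum>r\<leftarrow>qs. r * r)" .
      moreover have "2 * degree q \<le> degree p" if q: "q \<in> set ([:sqrt c:] # map (\<lambda>r. [:0, 1:] * r) rs)" for q
      proof -
        consider "q = [:sqrt c:]" | r where "r \<in> set rs" "q = [:0, 1:] * r"
          using q by (auto simp del: mult_pCons_left)
        then show ?thesis
        proof cases
          case 2
          then show ?thesis using bspec[OF rs, of r] deg1 deg_lin[of "[:0, 1:]" r]
            by (simp del: mult_pCons_left)
        qed simp
      qed
      moreover have "2 * degree r + 1 \<le> degree p" if "r \<in> set qs" for r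
        using bspec[OF qs that] deg1 by simp
      ultimately show ?thesis by blast
    next
      case False
      with a have "0 < a" by simp
      \<comment> \<open>At an interior minimum the first quotient changes sign, so it vanishes there as well.\<close>
      have "poly p1 a \<le> 0" by (rule poly_nonpos_left_limit[of 0]) (use p1_neg \<open>0 < a\<close> in auto)
      with p1_a have "poly p1 a = 0" by simp
      then obtain p2 where p2: "p1 = [:-a, 1:] * p2" by (metis dvdE poly_eq_0_iff_dvd)
      with \<open>p1 \<noteq> 0\<close> have "p2 \<noteq> 0" by auto
      then have deg2: "degree p = degree p2 + 2"
        using deg1 unfolding p2 by (subst (asm) degree_mult_eq) auto
      have p2_eq: "poly p1 x = (x - a) * poly p2 x" for x by (simp add: p2 algebra_simps)
      have p2_pos: "0 \<le> poly p2 x" if "a < x" for x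
        using p1_pos[OF that] p2_eq[of x] that by (simp add: zero_le_mult_iff)
      have p2_neg: "0 \<le> poly p2 x" if "0 \<le> x" "x < a" for x
        using p1_neg[OF that] p2_eq[of x] that by (simp add: mult_le_0_iff)
      have p2_a: "0 \<le> poly p2 a" by (rule poly_nonneg_right_limit[of a "a + 1"]) (use p2_pos in auto)
      have "\<And>x. 0 \<le> x \<Longrightarrow> 0 \<le> poly p2 x" using p2_pos p2_neg p2_a by (metis linorder_neqE)
      then have "\<exists>qs rs. p2 = (\<Sum>q\<leftarrow>qs. q * q) + [:0, 1:] * (\<Sum>r\<leftarrow>rs. r * r) \<and>
          (\<forall>q\<in>set qs. 2 * degree q \<le> degree p2) \<and> (\<forall>r\<in>set rs. 2 * degree r + 1 \<le> degree p2)"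
        by (intro less.hyps) (use deg2 in simp_all)
      then obtain qs rs where
        dec: "p2 = (\<Sum>q\<leftarrow>qs. q * q) + [:0, 1:] * (\<Sum>r\<leftarrow>rs. r * r)"
        and qs: "\<forall>q\<in>set qs. 2 * degree q \<le> degree p2"
        and rs: "\<forall>r\<in>set rs. 2 * degree r + 1 \<le> degree p2" by blast
      define l :: "real poly" where "l = [:-a, 1:]"
      then have dl: "degree l = 1" by simp
      have "p = [:c:] + (p - [:c:])" by simp
      also have "\<dots> = [:c:] + l * l * p2" unfolding p1 p2 l_def by (simp only: mult.assoc)
      finally have p_eq: "p = [:c:] + l * l * p2" .
      have "p = [:sqrt c:] * [:sqrt c:] + l * l * ((\<Sum>q\<leftarrow>qs. q * q) + [:0, 1:] * (\<Sum>r\<leftarrow>rs. r * r))"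
        unfolding const[OF c0, symmetric] dec[symmetric] by (rule p_eq)
      also have "\<dots> = (\<Sum>q\<leftarrow>[:sqrt c:] # map (\<lambda>r. l * r) qs. q * q)
          + [:0, 1:] * (\<Sum>r\<leftarrow>map (\<lambda>r. l * r) rs. r * r)"
        by (simp only: list.map sum_list.Cons map_map o_def sum_list_mult_squares)
          (simp only: distrib_left mult_ac add_ac)
      finally have "p = (\<Sum>q\<leftarrow>[:sqrt c:] # map (\<lambda>r. l * r) qs. q * q)
          + [:0, 1:] * (\<Sum>r\<leftarrow>map (\<lambda>r. l * r) rs. r * r)" .
      moreover have "2 * degree q \<le> degree p" if q: "q \<in> set ([:sqrt c:] # map (\<lambda>r. l * r) qs)" for q
      proof -
        consider "q = [:sqrt c:]" | r where "r \<in> set qs" "q = l * r" using q by auto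
        then show ?thesis
        proof cases
          case 2
          then show ?thesis using bspec[OF qs, of r] deg2 deg_lin[OF dl, of r] by simp
        qed simp
      qed
      moreover have "2 * degree q + 1 \<le> degree p" if q: "q \<in> set (map (\<lambda>r. l * r) rs)" for q
      proof -
        obtain r where "r \<in> set rs" "q = l * r" using q by auto
        then show ?thesis using bspec[OF rs, of r] deg2 deg_lin[OF dl, of r] by simp
      qed
      ultimately show ?thesis by blast
    qed
  qed
qed

section \<open>Lagrange interpolation and divided differences\<close>

text \<open>Up to the sign \<open>(-1) ^ (card S - 1)\<close> this is the derivative at \<open>x\<close> of the monic polynomial with root
set \<open>S\<close>, so its reciprocals are the weights of divided differences. The factors are oriented such
that the smallest element of \<open>S\<close> has positive weight; adjoining a new largest node then leaves all
old signs unchanged.\<close>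

definition nodal :: "real set \<Rightarrow> real \<Rightarrow> real" where
  "nodal S x = (\<Prod>y\<in>S - {x}. y - x)"

lemma nodal_nonzero: "finite S \<Longrightarrow> nodal S x \<noteq> 0"
  by (simp add: nodal_def)

lemma nodal_insert:
  assumes "finite S" "m \<notin> S" "x \<in> S"
  shows "nodal (insert m S) x = (m - x) * nodal S x"
proof -
  have "insert m S - {x} = insert m (S - {x})" using assms by auto
  then show ?thesis using assms by (simp add: nodal_def)
qed

text \<open>The signs alternate along the increasingly ordered nodes.\<close>

lemma card_nodal_pos:
  "finite S \<Longrightarrow> card {x\<in>S. 0 < nodal S x} = (card S + 1) div 2"
proof (induction rule: finite_linorder_max_induct)
  case (insert m S)
  have "m \<notin> S" using insert by auto
  have old: "0 < nodal (insert m S) x \<longleftrightarrow> 0 < nodal S x" if "x \<in> S" for x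
    using nodal_insert[of S m x] insert that \<open>m \<notin> S\<close> by (force simp: zero_less_mult_iff)
  have "nodal (insert m S) m = (\<Prod>y\<in>S. - (m - y))" using \<open>m \<notin> S\<close> by (simp add: nodal_def)
  also have "\<dots> = (-1) ^ card S * (\<Prod>y\<in>S. m - y)"
    by (subst prod_uminus) simp
  finally have new: "0 < nodal (insert m S) m \<longleftrightarrow> even (card S)"
    using prod_pos[of S "\<lambda>y. m - y"] insert by (cases "even (card S)") (auto simp: not_less less_imp_le)
  have "{x\<in>insert m S. 0 < nodal (insert m S) x} =
    (if even (card S) then insert m {x\<in>S. 0 < nodal S x} else {x\<in>S. 0 < nodal S x})"
    using old new by auto
  then show ?case using insert \<open>m \<notin> S\<close> by auto
qed simp

definition lagrange_basis :: "real set \<Rightarrow> real \<Rightarrow> real poly" where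
  "lagrange_basis S k = Polynomial.smult (\<Prod>y\<in>S - {k}. inverse (k - y)) (\<Prod>y\<in>S - {k}. [:-y, 1:])"

lemma degree_lagrange_basis_le:
  "finite S \<Longrightarrow> k \<in> S \<Longrightarrow> degree (lagrange_basis S k) \<le> card S - 1"
  unfolding lagrange_basis_def
  by (rule order.trans[OF degree_smult_le]) (simp add: degree_prod_sum_eq)

lemma poly_lagrange_basis:
  assumes "finite S" "k \<in> S" "x \<in> S"
  shows "poly (lagrange_basis S k) x = (if x = k then 1 else 0)"
proof (cases "x = k")
  case True
  have "(\<Prod>y\<in>S - {k}. inverse (k - y)) * (\<Prod>y\<in>S - {k}. k - y) = 1"
    using assms(1) unfolding prod.distrib[symmetric] by (intro prod.neutral) auto
  with True show ?thesis by (simp add: lagrange_basis_def poly_prod)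
next
  case False
  then have "(\<Prod>y\<in>S - {k}. x - y) = 0" using assms by (intro prod_zero) auto
  with False show ?thesis by (simp add: lagrange_basis_def poly_prod)
qed

lemma lagrange_interpolation:
  assumes "finite S" and "degree r < card S"
  shows "r = (\<Sum>k\<in>S. Polynomial.smult (poly r k) (lagrange_basis S k))"
proof (rule poly_eqI_degree[of S])
  fix x assume "x \<in> S"
  then show "poly r x = poly (\<Sum>k\<in>S. Polynomial.smult (poly r k) (lagrange_basis S k)) x"
    using assms by (simp add: poly_sum poly_lagrange_basis if_distrib[of "\<lambda>c. _ * c"] cong: if_cong)
next
  have "degree (\<Sum>k\<in>S. Polynomial.smult (poly r k) (lagrange_basis S k)) \<le> card S - 1"
    by (rule degree_sum_le[OF assms(1)])
      (use degree_lagrange_basis_le[OF assms(1)] degree_smult_le order.trans in blast)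
  with assms show "card S > degree (\<Sum>k\<in>S. Polynomial.smult (poly r k) (lagrange_basis S k))" by linarith
qed (use assms in auto)

text \<open>The sum is minus the divided difference of \<open>r\<close> over the nodes (minus, because an even number of
nodes leaves an odd number of factors to be reversed in each product), and a divided difference
is the top coefficient of the interpolation polynomial.\<close>

lemma sum_divided_difference:
  assumes fin: "finite S" and deg: "degree r < card S" and even: "even (card S)"
  shows "(\<Sum>x\<in>S. poly r x / nodal S x) = - coeff r (card S - 1)"
proof -
  have lc: "coeff (lagrange_basis S k) (card S - 1) = - inverse (nodal S k)" if "k \<in> S" for k
  proof -
    have "card (S - {k}) = card S - 1" using that fin by simp
    moreover have "degree (\<Prod>y\<in>S - {k}. [:-y, 1:]) = card (S - {k})"
      by (simp add: degree_prod_sum_eq)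
    moreover have "lead_coeff (\<Prod>y\<in>S - {k}. [:-y, 1::real:]) = 1"
      by (simp add: lead_coeff_prod)
    ultimately have "coeff (\<Prod>y\<in>S - {k}. [:-y, 1:]) (card S - 1) = 1" by simp
    moreover have "(\<Prod>y\<in>S - {k}. inverse (k - y)) = - inverse (nodal S k)"
    proof -
      have "(\<Prod>y\<in>S - {k}. inverse (k - y)) = inverse (\<Prod>y\<in>S - {k}. - (y - k))"
        by (simp add: prod_inversef[unfolded o_def])
      also have "\<dots> = inverse ((-1) ^ card (S - {k}) * nodal S k)"
        unfolding nodal_def by (subst prod_uminus) simp
      also have "odd (card (S - {k}))" using that fin even
          by (simp) (metis card_0_eq empty_iff even_Suc Suc_pred neq0_conv)
      then have "inverse ((-1) ^ card (S - {k}) * nodal S k) = - inverse (nodal S k)" by simp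
      finally show ?thesis .
    qed
    ultimately show ?thesis by (simp add: lagrange_basis_def)
  qed
  have "coeff r (card S - 1) = (\<Sum>k\<in>S. poly r k * coeff (lagrange_basis S k) (card S - 1))"
    by (subst lagrange_interpolation[OF fin deg]) (simp add: coeff_sum)
  also have "\<dots> = - (\<Sum>x\<in>S. poly r x / nodal S x)"
    by (simp add: lc sum_negf divide_inverse flip: One_nat_def)
  finally show ?thesis by simp
qed

section \<open>Adjoints, real diagonal matrices and unitary matrices\<close>

lemma dim_mat_adjoint [simp]:
  "dim_row (mat_adjoint A) = dim_col A" "dim_col (mat_adjoint A) = dim_row A"
  by (simp_all add: mat_adjoint_def)

lemma index_mat_adjoint [simp]:
  fixes A :: "complex mat"
  assumes "i < dim_col A" "j < dim_row A"
  shows "mat_adjoint A $$ (i, j) = cnj (A $$ (j, i))"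
  using assms by (simp add: mat_adjoint_def mat_of_rows_index)

lemmas [simp, intro] = mat_adjoint_carrier

lemma mat_adjoint_adjoint [simp]: "mat_adjoint (mat_adjoint A) = (A :: complex mat)"
  by (rule eq_matI) auto

lemma index_mult_sum:
  fixes A B :: "'a :: semiring_0 mat"
  assumes "A \<in> carrier_mat n m" "B \<in> carrier_mat m l" "i < n" "j < l"
  shows "(A * B) $$ (i, j) = (\<Sum>k<m. A $$ (i, k) * B $$ (k, j))"
  using assms by (auto simp: scalar_prod_def lessThan_atLeast0 intro!: sum.cong)

lemma mat_adjoint_mult:
  fixes A B :: "complex mat"
  assumes A: "A \<in> carrier_mat n m" and B: "B \<in> carrier_mat m l"
  shows "mat_adjoint (A * B) = mat_adjoint B * mat_adjoint A"
proof (rule eq_matI)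
  fix i j assume "i < dim_row (mat_adjoint B * mat_adjoint A)" "j < dim_col (mat_adjoint B * mat_adjoint A)"
  then have ij: "i < l" "j < n" using A B by auto
  have "mat_adjoint (A * B) $$ (i, j) = cnj ((A * B) $$ (j, i))"
    using A B ij by simp
  also have "\<dots> = (\<Sum>k<m. cnj (A $$ (j, k)) * cnj (B $$ (k, i)))"
    by (simp add: index_mult_sum[OF A B ij(2,1)])
  also have "\<dots> = (mat_adjoint B * mat_adjoint A) $$ (i, j)"
    using A B ij by (subst index_mult_sum[of _ l m _ n]) (auto intro!: sum.cong)
  finally show "mat_adjoint (A * B) $$ (i, j) = (mat_adjoint B * mat_adjoint A) $$ (i, j)" .
qed (use A B in auto)

lemma mat_adjoint_add:
  fixes A B :: "complex mat"
  assumes "A \<in> carrier_mat n m" "B \<in> carrier_mat n m"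
  shows "mat_adjoint (A + B) = mat_adjoint A + mat_adjoint B"
  by (rule eq_matI) (use assms in auto)

lemma mat_adjoint_minus:
  fixes A B :: "complex mat"
  assumes "A \<in> carrier_mat n m" "B \<in> carrier_mat n m"
  shows "mat_adjoint (A - B) = mat_adjoint A - mat_adjoint B"
  by (rule eq_matI) (use assms in auto)

lemma mat_adjoint_one [simp]: "mat_adjoint (1\<^sub>m n :: complex mat) = 1\<^sub>m n"
  by (rule eq_matI) auto

definition real_diag :: "nat \<Rightarrow> (nat \<Rightarrow> real) \<Rightarrow> complex mat" where
  "real_diag n d = mat_diag n (\<lambda>i. complex_of_real (d i))"

lemma real_diag_closed [simp]: "real_diag n d \<in> carrier_mat n n"
  by (simp add: real_diag_def)

lemma dim_real_diag [simp]: "dim_row (real_diag n d) = n" "dim_col (real_diag n d) = n"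
  by (simp_all add: real_diag_def mat_diag_def)

lemma index_real_diag [simp]:
  "i < n \<Longrightarrow> j < n \<Longrightarrow> real_diag n d $$ (i, j) = (if i = j then of_real (d i) else 0)"
  by (simp add: real_diag_def mat_diag_def)

lemma mat_adjoint_real_diag [simp]: "mat_adjoint (real_diag n d) = real_diag n d"
  by (rule eq_matI) auto

lemma real_diag_mult: "real_diag n d * real_diag n e = real_diag n (\<lambda>i. d i * e i)"
  by (simp add: real_diag_def)

lemma index_real_diag_mult:
  assumes "A \<in> carrier_mat n m" "i < n" "j < m"
  shows "(real_diag n d * A) $$ (i, j) = of_real (d i) * A $$ (i, j)"
  using assms by (simp add: real_diag_def mat_diag_mult_left[OF assms(1)])

lemma index_mult_real_diag:
  assumes "A \<in> carrier_mat m n" "i < m" "j < n"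
  shows "(A * real_diag n d) $$ (i, j) = A $$ (i, j) * of_real (d j)"
  using assms by (simp add: real_diag_def mat_diag_mult_right[OF assms(1)])

lemma index_conj_real_diag:
  assumes "U \<in> carrier_mat m n" "i < m" "j < m"
  shows "(U * real_diag n d * mat_adjoint U) $$ (i, j)
      = (\<Sum>k<n. U $$ (i, k) * of_real (d k) * cnj (U $$ (j, k)))"
proof -
  have "U * real_diag n d \<in> carrier_mat m n" using assms by auto
  then show ?thesis
    using assms by (subst index_mult_sum[of _ m n _ m])
      (auto simp: index_mult_real_diag[OF assms(1)] simp del: index_mult_mat(1) intro!: sum.cong)
qed

lemma unitary_matI:
  assumes "U \<in> carrier_mat n n" and "mat_adjoint U * U = 1\<^sub>m n"
  shows "unitary_mat n U"
  using assms mat_mult_left_right_inverse[of "mat_adjoint U" n U]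
  by (simp add: unitary_mat_def)

lemma unitary_mat_adjoint: "unitary_mat n U \<Longrightarrow> unitary_mat n (mat_adjoint U)"
  by (auto simp: unitary_mat_def)

lemma unitary_mat_mult:
  assumes U: "unitary_mat n U" and V: "unitary_mat n V"
  shows "unitary_mat n (U * V)"
proof (rule unitary_matI)
  note c = U[unfolded unitary_mat_def] V[unfolded unitary_mat_def]
  show "U * V \<in> carrier_mat n n" using c by auto
  have c': "U \<in> carrier_mat n n" "V \<in> carrier_mat n n"
      "mat_adjoint U \<in> carrier_mat n n" "mat_adjoint V \<in> carrier_mat n n"
    using c by auto
  have "mat_adjoint (U * V) * (U * V) = mat_adjoint V * mat_adjoint U * (U * V)"
    using c by (subst mat_adjoint_mult[of _ n n _ n]) auto
  also have "\<dots> = mat_adjoint V * ((mat_adjoint U * U) * V)"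
    using c' by (simp add: assoc_mult_mat[of _ n n _ n _ n] mult_carrier_mat[of _ n n _ n])
  also have "\<dots> = 1\<^sub>m n" using c left_mult_one_mat[OF c'(2)] by metis
  finally show "mat_adjoint (U * V) * (U * V) = 1\<^sub>m n" .
qed

section \<open>The spectral theorem\<close>

lemma exists_unitary_first_col:
  fixes v :: "complex vec"
  assumes v: "v \<in> carrier_vec n" and v0: "v \<noteq> 0\<^sub>v n" and n: "0 < n"
  obtains W c where "unitary_mat n W" and "col W 0 = c \<cdot>\<^sub>v v"
proof -
  define b where "b = basis_completion v"
  define ws where "ws = gram_schmidt n b"
  interpret cof_vec_space n "TYPE(complex)" .
  from basis_completion[OF v v0, folded b_def]
  have dist_b: "distinct b" and indep: "\<not> lin_dep (set b)" and b: "set b \<subseteq> carrier_vec n"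
    and hdb: "hd b = v" and len_b: "length b = n" by auto
  from hdb len_b n obtain vs where bv: "b = v # vs" by (cases b) auto
  from gram_schmidt_result[OF b dist_b indep refl, folded ws_def]
  have ws: "set ws \<subseteq> carrier_vec n" "corthogonal ws" "length ws = n"
    by (auto simp: len_b)
  from gram_schmidt_hd[OF v, of vs, folded bv] have hdws: "hd ws = v" unfolding ws_def .
  have ws0: "ws ! 0 = v" using hdws ws(3) n by (metis hd_conv_nth length_greater_0_conv)
  have wsc: "ws ! i \<in> carrier_vec n" if "i < n" for i using ws that by auto
  have dimw: "dim_vec (ws ! i) = n" if "i < n" for i using wsc[OF that] by auto
  define s where "s i = Re (ws ! i \<bullet>c ws ! i)" for i
  have s_eq: "ws ! i \<bullet>c ws ! i = of_real (s i)" and s_pos: "0 < s i" if "i < n" for i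
  proof -
    have ge: "0 \<le> ws ! i \<bullet>c ws ! i" by (rule conjugate_square_ge_0_vec)
    then show eq: "ws ! i \<bullet>c ws ! i = of_real (s i)"
      by (auto simp: s_def less_eq_complex_def complex_eq_iff)
    have "ws ! i \<bullet>c ws ! i \<noteq> 0" using corthogonalD[OF ws(2), of i i] that ws(3) by auto
    with ge eq show "0 < s i" by (auto simp: less_eq_complex_def less_le)
  qed
  define W where "W = Matrix.mat n n (\<lambda>(i, j). of_real (inverse (sqrt (s j))) * ws ! j $ i)"
  have W: "W \<in> carrier_mat n n" by (simp add: W_def)
  have "mat_adjoint W * W = 1\<^sub>m n"
  proof (rule eq_matI)
    fix i j assume "i < dim_row (1\<^sub>m n :: complex mat)" "j < dim_col (1\<^sub>m n :: complex mat)"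
    then have ij: "i < n" "j < n" by auto
    have "(mat_adjoint W * W) $$ (i, j) = (\<Sum>k<n. cnj (W $$ (k, i)) * W $$ (k, j))"
      using W ij by (subst index_mult_sum[of _ n n _ n]) auto
    also have "\<dots> = of_real (inverse (sqrt (s i)) * inverse (sqrt (s j))) * (ws ! j \<bullet>c ws ! i)"
      using ij dimw by (simp add: W_def scalar_prod_def sum_distrib_left lessThan_atLeast0 mult_ac)
    also have "\<dots> = 1\<^sub>m n $$ (i, j)"
    proof (cases "i = j")
      case True
      have "inverse (sqrt (s i)) * inverse (sqrt (s i)) * s i = 1"
        using s_pos[OF ij(1)] by (simp add: field_simps)
      then show ?thesis using True ij s_eq[OF ij(1)] by (simp flip: of_real_mult)
    next
      case False
      then have "ws ! j \<bullet>c ws ! i = 0" using corthogonalD[OF ws(2), of j i] ij ws(3) by auto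
      then show ?thesis using False ij by simp
    qed
    finally show "(mat_adjoint W * W) $$ (i, j) = 1\<^sub>m n $$ (i, j)" .
  qed (use W in auto)
  then have "unitary_mat n W" by (rule unitary_matI[OF W])
  moreover have "col W 0 = of_real (inverse (sqrt (s 0))) \<cdot>\<^sub>v v"
    by (rule eq_vecI) (use n v ws0 in \<open>auto simp: W_def\<close>)
  ultimately show ?thesis using that by blast
qed

text \<open>Deflation: a unitary matrix whose first column is an eigenvector brings \<open>A\<close> to a Hermitian matrix
with zeros in the first row and column off the diagonal; the induction hypothesis diagonalises
the remaining block.\<close>

theorem hermitian_spectral_decomp:
  assumes "A \<in> carrier_mat n n" and "hermitian_mat A"
  shows "\<exists>U d. unitary_mat n U \<and> A = U * real_diag n d * mat_adjoint U"
  using assms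
proof (induction n arbitrary: A)
  case 0
  then show ?case
    by (intro exI[of _ "1\<^sub>m 0"] exI[of _ "\<lambda>_. 0"]) (auto simp: unitary_mat_def intro!: eq_matI)
next
  case (Suc n)
  let ?N = "Suc n"
  note A = Suc.prems(1)
  have herm: "mat_adjoint A = A" using Suc.prems(2) by (simp add: hermitian_mat_def)
  obtain e where "eigenvalue A e"
    using spectrum_non_empty[OF A] by (auto simp: spectrum_def)
  then obtain v where v: "v \<in> carrier_vec ?N" "v \<noteq> 0\<^sub>v ?N" "A *\<^sub>v v = e \<cdot>\<^sub>v v"
    using A unfolding eigenvalue_def eigenvector_def by auto
  obtain W c where W: "unitary_mat ?N W" and col0: "col W 0 = c \<cdot>\<^sub>v v"
    using exists_unitary_first_col[OF v(1,2)] by auto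
  have Wc [simp]: "W \<in> carrier_mat ?N ?N" "mat_adjoint W \<in> carrier_mat ?N ?N"
    and WW: "mat_adjoint W * W = 1\<^sub>m ?N" "W * mat_adjoint W = 1\<^sub>m ?N"
    using W by (auto simp: unitary_mat_def)
  note [simp] = assoc_mult_mat[of _ ?N ?N _ ?N _ ?N] mult_carrier_mat[of _ ?N ?N _ ?N]
    left_mult_one_mat[of _ ?N ?N] right_mult_one_mat[of _ ?N ?N]
  define B where "B = mat_adjoint W * (A * W)"
  have B: "B \<in> carrier_mat ?N ?N" using A by (simp add: B_def)
  have "mat_adjoint B = B"
    unfolding B_def using A herm
    by (simp add: mat_adjoint_mult[of _ ?N ?N _ ?N])
  then have B_sym: "cnj (B $$ (j, i)) = B $$ (i, j)" if "i < ?N" "j < ?N" for i j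
    using index_mat_adjoint[of i B j] B that by simp
  have AB: "A = W * (B * mat_adjoint W)"
  proof -
    have "W * (B * mat_adjoint W) = (W * mat_adjoint W) * (A * (W * mat_adjoint W))"
      using A by (simp add: B_def del: WW)
    then show ?thesis using A WW by simp
  qed
  have AW0: "(A * W) $$ (k, 0) = e * W $$ (k, 0)" if "k < ?N" for k
  proof -
    have "col (A * W) 0 = A *\<^sub>v col W 0" using A Wc(1) by (intro col_mult2[of _ ?N ?N _ ?N]) auto
    also have "\<dots> = e \<cdot>\<^sub>v col W 0"
      unfolding col0 using v A by (simp add: mult_mat_vec[OF A v(1)] smult_smult_assoc mult.commute)
    finally have "col (A * W) 0 $ k = (e \<cdot>\<^sub>v col W 0) $ k" by simp
    moreover have "dim_row W = ?N" "dim_col W = ?N" using Wc(1) by blast+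
    ultimately show ?thesis using that A by simp
  qed
  have B_col: "B $$ (i, 0) = (if i = 0 then e else 0)" if "i < ?N" for i
  proof -
    have "B $$ (i, 0) = (\<Sum>k<?N. mat_adjoint W $$ (i, k) * (A * W) $$ (k, 0))"
      unfolding B_def using A that by (intro index_mult_sum[of _ ?N ?N _ ?N]) auto
    also have "\<dots> = e * (\<Sum>k<?N. mat_adjoint W $$ (i, k) * W $$ (k, 0))"
      unfolding sum_distrib_left by (intro sum.cong refl) (simp add: AW0)
    also have "(\<Sum>k<?N. mat_adjoint W $$ (i, k) * W $$ (k, 0)) = (mat_adjoint W * W) $$ (i, 0)"
      using that by (intro index_mult_sum[symmetric, of _ ?N ?N _ ?N]) auto
    finally show ?thesis using that by (simp add: WW)
  qed
  have B_row: "B $$ (0, i) = (if i = 0 then e else 0)" if "i < ?N" for i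
    using B_sym[of 0 i] B_col[OF that] B_sym[of 0 0] B_col[of 0] that by (auto split: if_splits)
  have e_real: "e = of_real (Re e)" using B_sym[of 0 0] B_col[of 0] by (simp add: complex_eq_iff)
  define C where "C = Matrix.mat n n (\<lambda>(i, j). B $$ (Suc i, Suc j))"
  have C: "C \<in> carrier_mat n n" by (simp add: C_def)
  have "mat_adjoint C = C"
    by (rule eq_matI) (auto simp: C_def B_sym)
  then have "hermitian_mat C" by (simp add: hermitian_mat_def)
  from Suc.IH[OF C this] obtain U d where U: "unitary_mat n U" and CU: "C = U * real_diag n d * mat_adjoint U"
    by blast
  have Uc: "U \<in> carrier_mat n n" and UU: "mat_adjoint U * U = 1\<^sub>m n" using U by (auto simp: unitary_mat_def)
  define P where "P = Matrix.mat ?N ?N (\<lambda>(i, j). if i = 0 \<or> j = 0 then (if i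
      = j then 1 else 0) else U $$ (i - 1, j - 1))"
  define d' where "d' i = (if i = 0 then Re e else d (i - 1))" for i
  have P [simp]: "P \<in> carrier_mat ?N ?N" and dimP [simp]: "dim_row P = ?N" "dim_col P = ?N"
    by (simp_all add: P_def)
  have "mat_adjoint P * P = 1\<^sub>m ?N"
  proof (rule eq_matI)
    fix i j assume "i < dim_row (1\<^sub>m ?N :: complex mat)" "j < dim_col (1\<^sub>m ?N :: complex mat)"
    then have ij: "i < ?N" "j < ?N" by auto
    have UUij: "(\<Sum>k<n. cnj (U $$ (k, i)) * U $$ (k, j)) = (if i = j then 1 else 0)" if "i < n" "j < n" for i j
    proof -
      have "(mat_adjoint U * U) $$ (i, j) = (\<Sum>k<n. cnj (U $$ (k, i)) * U $$ (k, j))"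
        using Uc that by (subst index_mult_sum[of _ n n _ n]) (auto intro!: sum.cong)
      then show ?thesis using that by (simp add: UU)
    qed
    have "(mat_adjoint P * P) $$ (i, j) = (\<Sum>k<?N. cnj (P $$ (k, i)) * P $$ (k, j))"
      using P ij by (subst index_mult_sum[of _ ?N ?N _ ?N]) (auto intro!: sum.cong simp del: P)
    also have "\<dots> = 1\<^sub>m ?N $$ (i, j)"
      unfolding sum.lessThan_Suc_shift using ij UUij
      by (cases i; cases j) (auto simp: P_def)
    finally show "(mat_adjoint P * P) $$ (i, j) = 1\<^sub>m ?N $$ (i, j)" .
  qed (use P in auto)
  then have uP: "unitary_mat ?N P" by (intro unitary_matI P)
  have BP: "B = P * real_diag ?N d' * mat_adjoint P"
  proof (rule eq_matI)
    fix i j assume "i < dim_row (P * real_diag ?N d' * mat_adjoint P)" "j < dim_col (P * real_diag ?N d' *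
        mat_adjoint P)"
    then have ij: "i < ?N" "j < ?N" using P by (auto simp del: P)
    have Cij: "B $$ (Suc i, Suc j) = (\<Sum>k<n. U $$ (i, k) * of_real (d k) * cnj (U $$ (j, k)))"
        if "i < n" "j < n" for i j
    proof -
      have "B $$ (Suc i, Suc j) = C $$ (i, j)" using that by (simp add: C_def)
      then show ?thesis unfolding CU using index_conj_real_diag[OF Uc that] by simp
    qed
    have "(P * real_diag ?N d' * mat_adjoint P) $$ (i, j)
        = (\<Sum>k<?N. P $$ (i, k) * of_real (d' k) * cnj (P $$ (j, k)))"
      by (rule index_conj_real_diag[OF P ij])
    also have "\<dots> = B $$ (i, j)"
      unfolding sum.lessThan_Suc_shift using ij Cij B_row B_col e_real
      by (cases i; cases j) (auto simp: P_def d'_def)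
    finally show "B $$ (i, j) = (P * real_diag ?N d' * mat_adjoint P) $$ (i, j)" by simp
  qed (use B P in \<open>auto simp del: P\<close>)
  have "A = (W * P) * real_diag ?N d' * mat_adjoint (W * P)"
    unfolding mat_adjoint_mult[OF Wc(1) P] using AB unfolding BP by simp
  with unitary_mat_mult[OF W uP] show ?case by blast
qed

section \<open>Positive semidefinite matrices and traces\<close>

lemma mat_trace_add:
  "A \<in> carrier_mat n n \<Longrightarrow> B \<in> carrier_mat n n \<Longrightarrow> mat_trace (A + B) = mat_trace A + mat_trace B"
  by (simp add: mat_trace_def sum.distrib)

lemma mat_trace_minus:
  "A \<in> carrier_mat n n \<Longrightarrow> B \<in> carrier_mat n n \<Longrightarrow> mat_trace (A - B) = mat_trace A - mat_trace B"
  by (simp add: mat_trace_def sum_subtractf)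

lemma mat_trace_smult:
  "A \<in> carrier_mat n n \<Longrightarrow> mat_trace (c \<cdot>\<^sub>m A) = c * mat_trace A"
  by (simp add: mat_trace_def sum_distrib_left)

lemma mat_trace_mult:
  assumes A: "A \<in> carrier_mat n m" and B: "B \<in> carrier_mat m n"
  shows "mat_trace (A * B) = (\<Sum>i<n. \<Sum>k<m. A $$ (i, k) * B $$ (k, i))"
  using A by (simp add: mat_trace_def index_mult_sum[OF A B] del: index_mult_mat(1))

lemma mat_trace_mult_comm:
  assumes A: "A \<in> carrier_mat n m" and B: "B \<in> carrier_mat m n"
  shows "mat_trace (A * B) = mat_trace (B * A)"
  unfolding mat_trace_mult[OF A B] mat_trace_mult[OF B A]
  by (subst sum.swap) (simp add: mult.commute)

lemma scalar_prod_conjugate_sum: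
  "v \<in> carrier_vec n \<Longrightarrow> w \<in> carrier_vec n \<Longrightarrow> w \<bullet>c v = (\<Sum>i<n. w $ i * cnj (v $ i))"
  by (auto simp: scalar_prod_def lessThan_atLeast0)

lemma mult_mat_vec_index_sum:
  "A \<in> carrier_mat n m \<Longrightarrow> v \<in> carrier_vec m \<Longrightarrow> i < n \<Longrightarrow> (A *\<^sub>v v) $ i = (\<Sum>k<m. A $$ (i, k) * v $ k)"
  by (auto simp: scalar_prod_def lessThan_atLeast0)

lemma mat_adjoint_scalar_prod:
  fixes S :: "complex mat"
  assumes S: "S \<in> carrier_mat n m" and v: "v \<in> carrier_vec m" and w: "w \<in> carrier_vec n"
  shows "(mat_adjoint S *\<^sub>v w) \<bullet>c v = w \<bullet>c (S *\<^sub>v v)"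
proof -
  have "(mat_adjoint S *\<^sub>v w) \<bullet>c v = (\<Sum>i<m. (\<Sum>k<n. cnj (S $$ (k, i)) * w $ k) * cnj (v $ i))"
    using S v w by (subst scalar_prod_conjugate_sum[of _ m])
      (auto simp: mult_mat_vec_index_sum[of _ m n] simp del: index_mult_mat_vec
        intro!: sum.cong mult_mat_vec_carrier[of _ m n])
  also have "\<dots> = (\<Sum>k<n. w $ k * cnj (\<Sum>i<m. S $$ (k, i) * v $ i))"
    unfolding sum_distrib_right cnj_sum sum_distrib_left
    by (subst sum.swap) (simp add: mult_ac)
  also have "\<dots> = w \<bullet>c (S *\<^sub>v v)"
    using S v w by (subst scalar_prod_conjugate_sum[of _ n])
      (auto simp: mult_mat_vec_index_sum[OF S v] simp del: index_mult_mat_vec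
        intro!: mult_mat_vec_carrier[of _ n m])
  finally show ?thesis .
qed

lemma psd_mat_congruence:
  assumes T: "T \<in> carrier_mat n n" "psd_mat T" and S: "S \<in> carrier_mat n m"
  shows "psd_mat (mat_adjoint S * T * S)"
  unfolding psd_mat_def hermitian_mat_def
proof (intro conjI ballI)
  note c [simp] = T(1) S mat_adjoint_carrier[OF S]
  have "mat_adjoint T = T" using T(2) by (simp add: psd_mat_def hermitian_mat_def)
  then show "mat_adjoint (mat_adjoint S * T * S) = mat_adjoint S * T * S"
    by (simp add: mat_adjoint_mult[of _ m n _ m] mat_adjoint_mult[of _ m n _ n]
        mult_carrier_mat[of _ m n _ n] mult_carrier_mat[of _ n n _ m]
        mat_adjoint_mult[of _ n n _ m] assoc_mult_mat[of _ m n _ n _ m])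
  fix v :: "complex vec" assume "v \<in> carrier_vec (dim_row (mat_adjoint S * T * S))"
  then have v: "v \<in> carrier_vec m" using S by auto
  have "(mat_adjoint S * T * S) *\<^sub>v v = mat_adjoint S *\<^sub>v (T *\<^sub>v (S *\<^sub>v v))"
    using v by (simp add: assoc_mult_mat_vec[of _ m n _ m] assoc_mult_mat_vec[of _ m n _ n]
        mult_carrier_mat[of _ m n _ n] mult_mat_vec_carrier[of _ n m])
  then have "((mat_adjoint S * T * S) *\<^sub>v v) \<bullet>c v = (T *\<^sub>v (S *\<^sub>v v)) \<bullet>c (S *\<^sub>v v)"
    using v by (simp add: mat_adjoint_scalar_prod[OF S] mult_mat_vec_carrier[of _ n m]
        mult_mat_vec_carrier[of _ n n])
  moreover have "S *\<^sub>v v \<in> carrier_vec (dim_row T)" using mult_mat_vec_carrier[OF S v] carrier_matD(1)[OF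
      T(1)] by simp
  ultimately show "0 \<le> ((mat_adjoint S * T * S) *\<^sub>v v) \<bullet>c v"
    using T(2) by (simp add: psd_mat_def)
qed

lemma psd_mat_add:
  assumes A: "A \<in> carrier_mat n n" "psd_mat A" and B: "B \<in> carrier_mat n n" "psd_mat B"
  shows "psd_mat (A + B)"
  unfolding psd_mat_def hermitian_mat_def
proof (intro conjI ballI)
  show "mat_adjoint (A + B) = A + B"
    using A B by (simp add: psd_mat_def hermitian_mat_def mat_adjoint_add[of _ n n])
  fix v :: "complex vec" assume "v \<in> carrier_vec (dim_row (A + B))"
  then have v: "v \<in> carrier_vec n" using B by auto
  have "((A + B) *\<^sub>v v) \<bullet>c v = (A *\<^sub>v v) \<bullet>c v + (B *\<^sub>v v) \<bullet>c v"
    using A(1) B(1) v by (simp add: add_mult_distrib_mat_vec[of _ n n] add_scalar_prod_distrib[of _ n]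
        mult_mat_vec_carrier[of _ n n])
  moreover have "0 \<le> (A *\<^sub>v v) \<bullet>c v" "0 \<le> (B *\<^sub>v v) \<bullet>c v" using A B v by (auto simp: psd_mat_def)
  ultimately show "0 \<le> ((A + B) *\<^sub>v v) \<bullet>c v" by simp
qed

lemma real_diag_quadratic_form:
  fixes v :: "complex vec"
  assumes v: "v \<in> carrier_vec n"
  shows "(real_diag n d *\<^sub>v v) \<bullet>c v = of_real (\<Sum>i<n. d i * (cmod (v $ i))\<^sup>2)"
proof -
  have "(real_diag n d *\<^sub>v v) \<bullet>c v = (\<Sum>i<n. (real_diag n d *\<^sub>v v) $ i * cnj (v $ i))"
    using v by (intro scalar_prod_conjugate_sum) (auto intro: mult_mat_vec_carrier[of _ n n])
  also have "\<dots> = (\<Sum>i<n. of_real (d i * (cmod (v $ i))\<^sup>2))"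
    using v by (intro sum.cong refl)
      (simp add: mult_mat_vec_index_sum[OF real_diag_closed v] if_distrib[of "\<lambda>c. c * _"]
        mult.assoc complex_norm_square[symmetric] cong: if_cong del: index_mult_mat_vec)
  finally show ?thesis by simp
qed

lemma psd_real_diag:
  assumes "\<And>i. i < n \<Longrightarrow> 0 \<le> d i"
  shows "psd_mat (real_diag n d)"
  using assms unfolding psd_mat_def hermitian_mat_def
  by (auto simp: real_diag_quadratic_form less_eq_complex_def intro!: sum_nonneg)

lemma psd_mat_diag_entry_nonneg:
  assumes T: "T \<in> carrier_mat n n" "psd_mat T" and i: "i < n"
  shows "0 \<le> T $$ (i, i)"
proof -
  have "T *\<^sub>v unit_vec n i = col T i" using T i by (intro eq_vecI) auto
  then have "(T *\<^sub>v unit_vec n i) \<bullet>c unit_vec n i = (\<Sum>k<n. T $$ (k, i) * cnj (unit_vec n i $ k))"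
    using T i by (subst scalar_prod_conjugate_sum[of _ n]) auto
  also have "\<dots> = T $$ (i, i)"
    using i by (simp add: if_distrib[of "\<lambda>c. _ * c"] if_distrib[of cnj] unit_vec_def cong: if_cong)
  finally show ?thesis using T by (metis psd_mat_def unit_vec_carrier carrier_matD(1))
qed

lemma psd_spectral_decomp:
  assumes A: "A \<in> carrier_mat n n" "psd_mat A"
  obtains U d where "unitary_mat n U" "A = U * real_diag n d * mat_adjoint U" "\<And>i. i < n \<Longrightarrow> 0 \<le> d i"
proof -
  have "hermitian_mat A" using A(2) by (simp add: psd_mat_def)
  then obtain U d where U: "unitary_mat n U" and AU: "A = U * real_diag n d * mat_adjoint U"
    using hermitian_spectral_decomp[OF A(1)] by blast
  have c: "U \<in> carrier_mat n n" "mat_adjoint U \<in> carrier_mat n n" and UU: "mat_adjoint U * U = 1\<^sub>m n"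
    using U by (auto simp: unitary_mat_def)
  have "mat_adjoint U * A * U = (mat_adjoint U * U) * (real_diag n d * (mat_adjoint U * U))"
    unfolding AU using c by (simp add: assoc_mult_mat[of _ n n _ n _ n] mult_carrier_mat[of _ n n _ n])
  then have eq: "mat_adjoint U * A * U = real_diag n d"
    by (simp add: UU left_mult_one_mat[of _ n n] right_mult_one_mat[of _ n n])
  have "0 \<le> d i" if "i < n" for i
    using psd_mat_diag_entry_nonneg[OF _ psd_mat_congruence[OF A c(1)] that] that
    unfolding eq by (simp add: less_eq_complex_def)
  with U AU that show ?thesis by blast
qed

lemma psd_conj_real_diag:
  assumes "U \<in> carrier_mat m n" and "\<And>i. i < n \<Longrightarrow> 0 \<le> d i"
  shows "psd_mat (U * real_diag n d * mat_adjoint U)"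
  using psd_mat_congruence[OF real_diag_closed psd_real_diag[OF assms(2)] mat_adjoint_carrier[OF assms(1)]]
  by simp

text \<open>In an eigenbasis of \<open>S\<close> the trace is a combination of the diagonal entries of \<open>T\<close>, which are
nonnegative, with the eigenvalues of \<open>S\<close> as coefficients.\<close>

lemma trace_psd_mult_psd:
  assumes S: "S \<in> carrier_mat n n" "psd_mat S" and T: "T \<in> carrier_mat n n" "psd_mat T"
  shows "0 \<le> Re (mat_trace (S * T))"
proof -
  obtain U d where U: "unitary_mat n U" and SU: "S = U * real_diag n d * mat_adjoint U"
    and d: "\<And>i. i < n \<Longrightarrow> 0 \<le> d i"
    using psd_spectral_decomp[OF S] by blast
  have c: "U \<in> carrier_mat n n" "mat_adjoint U \<in> carrier_mat n n"
    using U by (auto simp: unitary_mat_def)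
  note [simp] = assoc_mult_mat[of _ n n _ n _ n] mult_carrier_mat[of _ n n _ n]
  have "mat_trace (S * T) = mat_trace (U * (real_diag n d * (mat_adjoint U * T)))"
    unfolding SU using c T by simp
  also have "\<dots> = mat_trace ((real_diag n d * (mat_adjoint U * T)) * U)"
    using c T by (intro mat_trace_mult_comm) auto
  also have "\<dots> = mat_trace (real_diag n d * (mat_adjoint U * T * U))" using c T by simp
  also have "\<dots> = (\<Sum>i<n. of_real (d i) * (mat_adjoint U * T * U) $$ (i, i))"
    unfolding mat_trace_def using c T by (simp add: index_real_diag_mult[of _ n n] del: index_mult_mat(1))
  also have "Re \<dots> = (\<Sum>i<n. d i * Re ((mat_adjoint U * T * U) $$ (i, i)))" by simp
  also have "0 \<le> \<dots>"
  proof (intro sum_nonneg mult_nonneg_nonneg)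
    fix i assume i: "i \<in> {..<n}"
    then show "0 \<le> d i" using d by simp
    have "mat_adjoint U * T * U \<in> carrier_mat n n" using c T by simp
    from psd_mat_diag_entry_nonneg[OF this psd_mat_congruence[OF T c(1)], of i] i
    show "0 \<le> Re ((mat_adjoint U * T * U) $$ (i, i))" unfolding less_eq_complex_def by simp
  qed
  finally show ?thesis .
qed

lemma conj_real_diag_closed [simp]:
  "U \<in> carrier_mat n n \<Longrightarrow> U * real_diag n d * mat_adjoint U \<in> carrier_mat n n"
  by auto

lemma conj_real_diag_mult:
  assumes U: "unitary_mat n U"
  shows "(U * real_diag n d * mat_adjoint U) * (U * real_diag n e * mat_adjoint U)
    = U * real_diag n (\<lambda>i. d i * e i) * mat_adjoint U"
proof -
  have c: "U \<in> carrier_mat n n" "mat_adjoint U \<in> carrier_mat n n" and UU: "mat_adjoint U * U = 1\<^sub>m n"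
    using U by (auto simp: unitary_mat_def)
  note [simp] = assoc_mult_mat[of _ n n _ n _ n] mult_carrier_mat[of _ n n _ n]
  have "(U * real_diag n d * mat_adjoint U) * (U * real_diag n e * mat_adjoint U)
      = U * (real_diag n d * ((mat_adjoint U * U) * (real_diag n e * mat_adjoint U)))"
    using c by (simp del: UU)
  also have "\<dots> = U * ((real_diag n d * real_diag n e) * mat_adjoint U)"
    unfolding UU using c by (simp add: left_mult_one_mat[of _ n n])
  finally show ?thesis using c unfolding real_diag_mult by simp
qed

lemma conj_real_diag_const:
  assumes U: "unitary_mat n U"
  shows "U * real_diag n (\<lambda>_. 1) * mat_adjoint U = 1\<^sub>m n"
proof -
  have "real_diag n (\<lambda>_. 1) = 1\<^sub>m n" by (rule eq_matI) auto
  then show ?thesis using U by (simp add: unitary_mat_def right_mult_one_mat[of U n n])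
qed

lemma conj_real_diag_lin:
  assumes U: "U \<in> carrier_mat n n"
  shows "U * real_diag n (\<lambda>i. d i + k * e i) * mat_adjoint U
    = U * real_diag n d * mat_adjoint U + of_real k \<cdot>\<^sub>m (U * real_diag n e * mat_adjoint U)"
proof (rule eq_matI)
  let ?R = "U * real_diag n d * mat_adjoint U + of_real k \<cdot>\<^sub>m (U * real_diag n e * mat_adjoint U)"
  fix i j assume "i < dim_row ?R" "j < dim_col ?R"
  then have ij: "i < n" "j < n" using U by auto
  have "(U * real_diag n (\<lambda>i. d i + k * e i) * mat_adjoint U) $$ (i, j)
      = (\<Sum>l<n. U $$ (i, l) * of_real (d l) * cnj (U $$ (j, l)))
        + of_real k * (\<Sum>l<n. U $$ (i, l) * of_real (e l) * cnj (U $$ (j, l)))"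
    unfolding index_conj_real_diag[OF U ij] sum_distrib_left sum.distrib[symmetric]
    by (intro sum.cong refl) (simp add: algebra_simps)
  also have "\<dots> = ?R $$ (i, j)"
    unfolding index_conj_real_diag[OF U ij, symmetric]
    using ij carrier_matD[OF conj_real_diag_closed[OF U]] by (simp del: index_mult_mat)
  finally show "(U * real_diag n (\<lambda>i. d i + k * e i) * mat_adjoint U) $$ (i, j) = ?R $$ (i, j)" .
qed (use U in auto)

lemma diag_entry_conj_real_diag:
  assumes "U \<in> carrier_mat n n" "i < n"
  shows "(U * real_diag n d * mat_adjoint U) $$ (i, i) = of_real (\<Sum>j<n. (cmod (U $$ (i, j)))\<^sup>2 * d j)"
  unfolding index_conj_real_diag[OF assms assms(2)] of_real_sum
  by (intro sum.cong refl) (simp add: complex_norm_square mult_ac del: of_real_power)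

lemma spectral_decomp_conj:
  assumes "unitary_mat n U"
  shows "spectral_decomp (U * real_diag n d * mat_adjoint U) U d"
  using assms by (auto simp: spectral_decomp_def real_diag_def unitary_mat_def)

lemma mat_fun_conj_real_diag:
  assumes "unitary_mat n U"
  shows "mat_fun f (U * real_diag n d * mat_adjoint U) = U * real_diag n (\<lambda>i. f (d i)) * mat_adjoint U"
  using mat_fun_eq[OF spectral_decomp_conj[OF assms], of f d] assms carrier_matD(1)[of U n n]
  by (simp add: real_diag_def unitary_mat_def)

lemma conj_quadratic_form:
  fixes v :: "complex vec"
  assumes Q: "Q \<in> carrier_mat m n" and v: "v \<in> carrier_vec n"
  shows "((mat_adjoint Q * real_diag m d * Q) *\<^sub>v v) \<bullet>c v = of_real (\<Sum>i<m. d i * (cmod ((Q *\<^sub>v v) $ i))\<^sup>2)"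
proof -
  have Qv: "Q *\<^sub>v v \<in> carrier_vec m" using Q v by (rule mult_mat_vec_carrier)
  have "(mat_adjoint Q * real_diag m d * Q) *\<^sub>v v = mat_adjoint Q *\<^sub>v (real_diag m d *\<^sub>v (Q *\<^sub>v v))"
    using Q v Qv mat_adjoint_carrier[OF Q]
    by (simp add: assoc_mult_mat_vec[of _ n m _ n] assoc_mult_mat_vec[of _ n m _ m] mult_carrier_mat[of _ n
        m _ m])
  then show ?thesis
    using mat_adjoint_scalar_prod[OF Q v] real_diag_quadratic_form[OF Qv]
    by (simp add: mult_mat_vec_carrier[OF real_diag_closed Qv])
qed

lemma trace_conj_real_diag:
  assumes U: "unitary_mat n U"
  shows "mat_trace (U * real_diag n d * mat_adjoint U) = of_real (\<Sum>i<n. d i)"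
proof -
  have c: "U \<in> carrier_mat n n" "mat_adjoint U \<in> carrier_mat n n" and UU: "mat_adjoint U * U = 1\<^sub>m n"
    using U by (auto simp: unitary_mat_def)
  have "mat_trace (U * real_diag n d * mat_adjoint U) = mat_trace (mat_adjoint U * (U * real_diag n d))"
    using c by (intro mat_trace_mult_comm[of _ n n]) auto
  also have "\<dots> = mat_trace ((mat_adjoint U * U) * real_diag n d)"
    using c by (simp add: assoc_mult_mat[of _ n n _ n _ n])
  finally show ?thesis
    unfolding UU by (simp add: left_mult_one_mat[of _ n n] mat_trace_def)
qed

lemma trace_mult_conj_real_diag:
  assumes Z: "unitary_mat n Z" and U: "unitary_mat n U"
  shows "mat_trace ((Z * real_diag n \<delta> * mat_adjoint Z) * (U * real_diag n h * mat_adjoint U))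
    = of_real (\<Sum>i<n. \<delta> i * (\<Sum>j<n. (cmod ((mat_adjoint Z * U) $$ (i, j)))\<^sup>2 * h j))"
proof -
  have c: "Z \<in> carrier_mat n n" "mat_adjoint Z \<in> carrier_mat n n" "U \<in> carrier_mat n n"
      "mat_adjoint U \<in> carrier_mat n n"
    using Z U by (auto simp: unitary_mat_def)
  define W where "W = mat_adjoint Z * U"
  have W: "W \<in> carrier_mat n n" unfolding W_def using c(2,3) by (rule mult_carrier_mat)
  have Wadj: "mat_adjoint W = mat_adjoint U * Z"
    unfolding W_def by (simp add: mat_adjoint_mult[OF c(2,3)])
  note [simp] = assoc_mult_mat[of _ n n _ n _ n] mult_carrier_mat[of _ n n _ n]
  have "mat_trace ((Z * real_diag n \<delta> * mat_adjoint Z) * (U * real_diag n h * mat_adjoint U))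
      = mat_trace (Z * (real_diag n \<delta> * (mat_adjoint Z * (U * (real_diag n h * mat_adjoint U)))))"
    using c by simp
  also have "\<dots> = mat_trace ((real_diag n \<delta> * (mat_adjoint Z * (U * (real_diag n h * mat_adjoint U)))) * Z)"
    using c by (intro mat_trace_mult_comm[of _ n n]) auto
  also have "\<dots> = mat_trace (real_diag n \<delta> * (W * real_diag n h * mat_adjoint W))"
    unfolding Wadj using c by (simp add: W_def)
  also have "\<dots> = (\<Sum>i<n. of_real (\<delta> i) * (W * real_diag n h * mat_adjoint W) $$ (i, i))"
    unfolding mat_trace_def using conj_real_diag_closed[OF W]
    by (simp add: index_real_diag_mult[of _ n n] del: index_mult_mat(1) assoc_mult_mat)
  also have "\<dots> = of_real (\<Sum>i<n. \<delta> i * (\<Sum>j<n. (cmod (W $$ (i, j)))\<^sup>2 * h j))"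
    unfolding of_real_sum of_real_mult[of "\<delta> _"]
        by (intro sum.cong refl) (simp add: diag_entry_conj_real_diag[OF W] del: assoc_mult_mat)
  finally show ?thesis unfolding W_def .
qed

lemma mat_abs_conj_real_diag:
  assumes Z: "unitary_mat n Z"
  shows "mat_abs (Z * real_diag n d * mat_adjoint Z) = Z * real_diag n (\<lambda>i. \<bar>d i\<bar>) * mat_adjoint Z"
proof -
  have c: "Z \<in> carrier_mat n n" using Z by (simp add: unitary_mat_def)
  have "mat_adjoint (Z * real_diag n d * mat_adjoint Z) = Z * real_diag n d * mat_adjoint Z"
    using c by (simp add: mat_adjoint_mult[of _ n n _ n] assoc_mult_mat[of _ n n _ n _ n]
        mult_carrier_mat[of _ n n _ n])
  then show ?thesis
    unfolding mat_abs_def by (simp only: conj_real_diag_mult[OF Z] mat_fun_conj_real_diag[OF Z]) simp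
qed

lemma unitary_row_sum:
  assumes U: "unitary_mat n U" and i: "i < n"
  shows "(\<Sum>j<n. (cmod (U $$ (i, j)))\<^sup>2) = 1"
proof -
  have "U \<in> carrier_mat n n" using U by (simp add: unitary_mat_def)
  from diag_entry_conj_real_diag[OF this i, of "\<lambda>_. 1"]
  have "complex_of_real (\<Sum>j<n. (cmod (U $$ (i, j)))\<^sup>2) = 1"
    unfolding conj_real_diag_const[OF U] using i by simp
  then show ?thesis by (simp only: of_real_eq_1_iff)
qed

section \<open>The trace inequality for resolvents\<close>

text \<open>The bound comes from the positivity of a single trace. Think of \<open>M\<close> as \<open>B + s\<close> with \<open>B\<close> positive
semidefinite, so that \<open>X\<close> is the inverse of \<open>B + s\<close> and \<open>R\<close> that of \<open>B + P + s\<close>. The left-hand side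
of the second claim is then \<open>s * Tr (P * (X - R))\<close>, and the right-hand side is its value for \<open>B = 0\<close>.

The resolvent identity \<open>X = R + R P X\<close> gives the first claim after one more substitution of it into
itself. For the second, \<open>R + R M R = 2 R - R P R\<close> and \<open>P (1 - s X) P\<close> are both positive
semidefinite, so the trace of their product is nonnegative. Eliminating \<open>X\<close> from the quartic terms
by the resolvent identity leaves
\<open>s * Tr (P (X - R)) \<le> 2 * Tr (R P\<^sup>2) - Tr (R P R P\<^sup>2) - s * Tr (R P R P)\<close>.
As \<open>P\<close> is diagonal, the terms quadratic in \<open>R\<close> are sums of \<open>|R_ij|\<^sup>2\<close> with nonnegative coefficients.
Keeping only the diagonal entries \<open>r\<^sub>i\<close>, the bound becomes a sum of the terms
\<open>p\<^sub>i\<^sup>2 * (2 * r\<^sub>i - (p\<^sub>i + s) * r\<^sub>i\<^sup>2)\<close>, and completing the square gives \<open>p\<^sub>i\<^sup>2 / (p\<^sub>i + s)\<close>.\<close>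

lemma resolvent_trace_bound:
  fixes p :: "nat \<Rightarrow> real" and s :: real and n :: nat
  defines "P \<equiv> real_diag n p"
  assumes carr: "M \<in> carrier_mat n n" "X \<in> carrier_mat n n" "R \<in> carrier_mat n n"
    and psd: "psd_mat M" "psd_mat X" "psd_mat R" "psd_mat (1\<^sub>m n - of_real s \<cdot>\<^sub>m X)"
    and inv: "M * X = 1\<^sub>m n" "R * (M + P) = 1\<^sub>m n"
    and s: "0 < s" and p: "\<And>i. i < n \<Longrightarrow> 0 \<le> p i"
  shows "\<And>i. i < n \<Longrightarrow> Re (R $$ (i, i)) \<le> Re (X $$ (i, i))"
    and "s * (\<Sum>i<n. p i * (Re (X $$ (i, i)) - Re (R $$ (i, i)))) \<le> (\<Sum>i<n. (p i)\<^sup>2 / (p i + s))"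
proof -
  note [simp] = assoc_mult_mat[of _ n n _ n _ n] mult_carrier_mat[of _ n n _ n] carr
    left_mult_one_mat[of _ n n] right_mult_one_mat[of _ n n]
    add_mult_distrib_mat[of _ n n _ _ n] mult_add_distrib_mat[of _ n n _ n]
    minus_mult_distrib_mat[of _ n n _ _ n] mult_minus_distrib_mat[of _ n n _ n]
    mult_smult_distrib[of _ n n _ n] mult_smult_assoc_mat[of _ n n _ n]
    mat_trace_add[of _ n] mat_trace_minus[of _ n] mat_trace_smult[of _ n]
  have P [simp]: "P \<in> carrier_mat n n" by (simp add: P_def)
  have adj: "mat_adjoint X = X" "mat_adjoint R = R" "mat_adjoint P = P"
    using psd by (auto simp: psd_mat_def hermitian_mat_def P_def)
  have psdP: "psd_mat P" unfolding P_def by (rule psd_real_diag) (rule p)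
  have X_eq: "X = R + R * (P * X)"
  proof -
    have "X = (R * (M + P)) * X" by (simp add: inv del: mult_add_distrib_mat)
    also have "\<dots> = R * (M * X) + R * (P * X)" by (simp del: inv)
    finally show ?thesis using inv by simp
  qed
  have RMR: "R * (M * R) + R * (P * R) = R"
  proof -
    have "R = (R * (M + P)) * R" by (simp add: inv del: mult_add_distrib_mat)
    also have "\<dots> = R * (M * R) + R * (P * R)" by (simp del: inv)
    finally show ?thesis by simp
  qed
  have X_eq': "X = R + X * (P * R)"
    using arg_cong[OF X_eq, of mat_adjoint]
    by (simp add: mat_adjoint_add[of _ n n] mat_adjoint_mult[of _ n n _ n] adj)
  define E where "E = R * (P * R) + R * (P * (X * (P * R)))"
  have E [simp]: "E \<in> carrier_mat n n" by (simp add: E_def)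
  have XE: "X = R + E"
    unfolding E_def by (subst X_eq, subst X_eq') simp
  have "psd_mat (R * (P * R))"
    using psd_mat_congruence[OF P psdP carr(3)] adj by simp
  moreover have "psd_mat (R * (P * (X * (P * R))))"
    using psd_mat_congruence[OF carr(2) psd(2), of "P * R" n] adj
        by (simp add: mat_adjoint_mult[of _ n n _ n])
  ultimately have psdE: "psd_mat E" unfolding E_def by (intro psd_mat_add[of _ n]) simp_all
  show "Re (R $$ (i, i)) \<le> Re (X $$ (i, i))" if "i < n" for i
    using psd_mat_diag_entry_nonneg[OF E psdE that] arg_cong[OF XE, of "\<lambda>Z. Re (Z $$ (i, i))"] that
      carrier_matD[OF E] carrier_matD[OF carr(3)] by (simp add: less_eq_complex_def)

  define G where "G = 1\<^sub>m n - of_real s \<cdot>\<^sub>m X"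
  have G [simp]: "G \<in> carrier_mat n n" unfolding G_def by (intro minus_carrier_mat smult_carrier_mat carr)
  \<comment> \<open>\<open>Y\<close> is positive semidefinite; it is paired with \<open>R\<close> and with \<open>R M R\<close>.\<close>
  define Y where "Y = P * (G * P)"
  have Y [simp]: "Y \<in> carrier_mat n n" by (simp add: Y_def)
  have psdY: "psd_mat Y" using psd_mat_congruence[OF G psd(4)[folded G_def] P] adj by (simp add: Y_def)
  have "0 \<le> Re (mat_trace (R * Y))" using psd psdY by (intro trace_psd_mult_psd[of _ n]) auto
  moreover have "0 \<le> Re (mat_trace (M * (R * (Y * R))))"
    using psd_mat_congruence[OF Y psdY carr(3)] adj psd by (intro trace_psd_mult_psd[of _ n]) auto
  moreover have "mat_trace (M * (R * (Y * R))) = mat_trace (R * (M * (R * Y)))"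
    using mat_trace_mult_comm[of "M * (R * Y)" n n R] by simp
  moreover have "mat_trace (R * (M * (R * Y))) + mat_trace (R * (P * (R * Y))) = mat_trace (R * Y)"
    using arg_cong[OF RMR, of "\<lambda>Z. mat_trace (Z * Y)"] by simp
  ultimately have pos: "0 \<le> 2 * Re (mat_trace (R * Y)) - Re (mat_trace (R * (P * (R * Y))))"
    by (simp add: complex_eq_iff)
  have Y_eq: "Y = P * P - of_real s \<cdot>\<^sub>m (P * (X * P))" by (simp add: Y_def G_def)
  \<comment> \<open>The resolvent identity removes \<open>X\<close> from the interior of the traces in \<open>pos\<close>.\<close>
  have z1: "mat_trace (X * P) = mat_trace (R * P) + mat_trace (R * (P * (X * P)))"
    using arg_cong[OF X_eq, of "\<lambda>Z. mat_trace (Z * P)"] by simp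
  have z2: "mat_trace (R * (P * (X * P))) = mat_trace (R * (P * (R * P)))
      + mat_trace (R * (P * (R * (P * (X * P)))))"
    using arg_cong[OF X_eq, of "\<lambda>Z. mat_trace (R * (P * (Z * P)))"] by simp
  have main: "s * (Re (mat_trace (X * P)) - Re (mat_trace (R * P)))
      \<le> 2 * Re (mat_trace (R * (P * P))) - Re (mat_trace (R * (P * (R * (P * P)))))
          - s * Re (mat_trace (R * (P * (R * P))))"
    using pos z1 z2 unfolding Y_eq by (simp add: algebra_simps complex_eq_iff)
  define r where "r i = Re (R $$ (i, i))" for i
  have tr1: "Re (mat_trace (Z * real_diag n h)) = (\<Sum>i<n. h i * Re (Z $$ (i, i)))"
      if "Z \<in> carrier_mat n n" for Z h
    using that by (simp add: mat_trace_def index_mult_real_diag[OF that] mult.commute del: index_mult_mat(1))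
  have tr2: "(\<Sum>i<n. p i * h i * (r i)\<^sup>2) \<le> Re (mat_trace (R * (P * (R * real_diag n h))))"
    if h: "\<And>i. i < n \<Longrightarrow> 0 \<le> h i" for h
  proof -
    have "mat_trace (R * (P * (R * real_diag n h)))
        = (\<Sum>i<n. \<Sum>k<n. R $$ (i, k) * (P * (R * real_diag n h)) $$ (k, i))"
      by (rule mat_trace_mult) auto
    also have "\<dots> = (\<Sum>i<n. \<Sum>k<n. of_real (p k * h i * (cmod (R $$ (i, k)))\<^sup>2))"
    proof (intro sum.cong refl)
      fix i k assume ik: "i \<in> {..<n}" "k \<in> {..<n}"
      have "cnj (R $$ (i, k)) = R $$ (k, i)"
        using ik index_mat_adjoint[of k R i] carr(3) adj(2) by simp
      then have "of_real ((cmod (R $$ (i, k)))\<^sup>2) = R $$ (i, k) * R $$ (k, i)"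
        by (metis complex_norm_square)
      then show "R $$ (i, k) * (P * (R * real_diag n h)) $$ (k, i)
          = of_real (p k * h i * (cmod (R $$ (i, k)))\<^sup>2)"
        using ik unfolding P_def
        by (simp add: index_real_diag_mult[of _ n n] index_mult_real_diag[of _ n n] del: index_mult_mat(1))
    qed
    also have "Re \<dots> = (\<Sum>i<n. \<Sum>k<n. p k * h i * (cmod (R $$ (i, k)))\<^sup>2)" by simp
    also have "\<dots> \<ge> (\<Sum>i<n. p i * h i * (r i)\<^sup>2)"
    proof (rule sum_mono)
      fix i assume i: "i \<in> {..<n}"
      have "(r i)\<^sup>2 \<le> (cmod (R $$ (i, i)))\<^sup>2"
        unfolding r_def by (metis abs_Re_le_cmod abs_ge_zero power2_abs power_mono)
      then have "p i * h i * (r i)\<^sup>2 \<le> p i * h i * (cmod (R $$ (i, i)))\<^sup>2"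
        using p h i by (intro mult_left_mono) auto
      also have "\<dots> \<le> (\<Sum>k<n. p k * h i * (cmod (R $$ (i, k)))\<^sup>2)"
        using p h i by (intro member_le_sum[of i "{..<n}" "\<lambda>k. p k * h i * (cmod (R $$ (i, k)))\<^sup>2"]) auto
      finally show "p i * h i * (r i)\<^sup>2 \<le> (\<Sum>k<n. p k * h i * (cmod (R $$ (i, k)))\<^sup>2)" .
    qed
    finally show ?thesis .
  qed
  have PP: "P * P = real_diag n (\<lambda>i. p i * p i)" by (simp add: P_def real_diag_mult)
  have "s * (\<Sum>i<n. p i * (Re (X $$ (i, i)) - r i)) = s * (Re (mat_trace (X * P)) - Re (mat_trace (R * P)))"
    unfolding P_def tr1[OF carr(2)] tr1[OF carr(3)] by (simp add: r_def right_diff_distrib sum_subtractf)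
  also have "\<dots> \<le> 2 * (\<Sum>i<n. p i * p i * r i) - (\<Sum>i<n. p i * (p i * p i) * (r i)\<^sup>2)
      - s * (\<Sum>i<n. p i * p i * (r i)\<^sup>2)"
  proof -
    have "(\<Sum>i<n. p i * (p i * p i) * (r i)\<^sup>2) \<le> Re (mat_trace (R * (P * (R * (P * P)))))"
      unfolding PP by (rule tr2) simp
    moreover have "s * (\<Sum>i<n. p i * p i * (r i)\<^sup>2) \<le> s * Re (mat_trace (R * (P * (R * P))))"
      using tr2[of p] p s by (simp add: P_def)
    moreover have "Re (mat_trace (R * (P * P))) = (\<Sum>i<n. p i * p i * r i)"
      unfolding PP r_def by (rule tr1) simp
    ultimately show ?thesis using main by linarith
  qed
  also have "\<dots> = (\<Sum>i<n. (p i)\<^sup>2 * (2 * r i - (p i + s) * (r i)\<^sup>2))"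
    by (simp add: sum_distrib_left sum_subtractf[symmetric] algebra_simps power2_eq_square)
  also have "\<dots> \<le> (\<Sum>i<n. (p i)\<^sup>2 / (p i + s))"
  proof (rule sum_mono)
    have square: "q * (x - 1 / q)\<^sup>2 = 1 / q - (2 * x - q * x\<^sup>2)" if "q \<noteq> 0" for q x :: real
      using that by (simp add: power2_eq_square field_simps)
    fix i assume "i \<in> {..<n}"
    then have pos: "0 < p i + s" using p[of i] s by simp
    have "0 \<le> (p i + s) * (r i - 1 / (p i + s))\<^sup>2" using pos by simp
    also have "\<dots> = 1 / (p i + s) - (2 * r i - (p i + s) * (r i)\<^sup>2)"
      using pos square[of "p i + s" "r i"] by simp
    finally have "(p i)\<^sup>2 * (2 * r i - (p i + s) * (r i)\<^sup>2) \<le> (p i)\<^sup>2 * (1 / (p i + s))"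
      by (intro mult_left_mono) auto
    then show "(p i)\<^sup>2 * (2 * r i - (p i + s) * (r i)\<^sup>2) \<le> (p i)\<^sup>2 / (p i + s)" by simp
  qed
  finally show "s * (\<Sum>i<n. p i * (Re (X $$ (i, i)) - Re (R $$ (i, i)))) \<le> (\<Sum>i<n. (p i)\<^sup>2 / (p i + s))"
    by (simp add: r_def)
qed

lemma resolvent_properties:
  fixes s :: real and c :: "nat \<Rightarrow> real"
  assumes W: "unitary_mat n W" and c: "\<forall>i<n. 0 \<le> c i" and s: "0 < s"
  defines "M \<equiv> W * real_diag n c * mat_adjoint W + of_real s \<cdot>\<^sub>m 1\<^sub>m n"
    and "X \<equiv> W * real_diag n (\<lambda>i. 1 / (c i + s)) * mat_adjoint W"
  shows "M \<in> carrier_mat n n" "X \<in> carrier_mat n n" "psd_mat M" "psd_mat X"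
    "psd_mat (1\<^sub>m n - of_real s \<cdot>\<^sub>m X)" "M * X = 1\<^sub>m n" "X * M = 1\<^sub>m n"
proof -
  have Wc: "W \<in> carrier_mat n n" using W by (simp add: unitary_mat_def)
  note one = conj_real_diag_const[OF W]
  have pos: "0 < c i + s" if "i < n" for i using c that s by force
  have M_eq: "M = W * real_diag n (\<lambda>i. c i + s) * mat_adjoint W"
    using conj_real_diag_lin[OF Wc, of c s "\<lambda>_. 1"] unfolding one M_def by simp
  show M: "M \<in> carrier_mat n n" and X: "X \<in> carrier_mat n n" using Wc by (simp_all add: M_def X_def)
  show "psd_mat M" unfolding M_eq using Wc pos by (intro psd_conj_real_diag) (auto intro: less_imp_le)
  show "psd_mat X" unfolding X_def using Wc pos by (intro psd_conj_real_diag) (auto intro: less_imp_le)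
  have "1\<^sub>m n - of_real s \<cdot>\<^sub>m X = 1\<^sub>m n + of_real (- s) \<cdot>\<^sub>m X"
    using X by (intro eq_matI) auto
  also have "\<dots> = W * real_diag n (\<lambda>i. 1 + - s * (1 / (c i + s))) * mat_adjoint W"
    unfolding X_def one[symmetric] by (rule conj_real_diag_lin[OF Wc, symmetric])
  finally have "1\<^sub>m n - of_real s \<cdot>\<^sub>m X = W * real_diag n (\<lambda>i. 1 + - s * (1 / (c i + s))) * mat_adjoint W" .
  moreover have "0 \<le> 1 + - s * (1 / (c i + s))" if "i < n" for i
    using pos[OF that] c that by (simp add: field_simps)
  ultimately show "psd_mat (1\<^sub>m n - of_real s \<cdot>\<^sub>m X)"
    using psd_conj_real_diag[OF Wc] by simp
  have diag1: "real_diag n (\<lambda>i. (c i + s) * (1 / (c i + s))) = real_diag n (\<lambda>_. 1)"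
    using pos by (intro eq_matI) (auto simp: less_imp_neq[symmetric])
  show MX: "M * X = 1\<^sub>m n"
    unfolding M_eq X_def conj_real_diag_mult[OF W] diag1 one ..
  show "X * M = 1\<^sub>m n" using mat_mult_left_right_inverse[OF M X MX] .
qed

text \<open>The trace inequality for \<open>x / (x + s)\<close>, in the basis that diagonalises the difference \<open>A - B\<close>. Split
its eigenvalues into positive and negative parts, \<open>\<delta> = p - q\<close>. Then \<open>C = B + p = A + q\<close> dominates both
matrices, and with \<open>X\<close>, \<open>Z\<close>, \<open>R\<close> the resolvents of \<open>B\<close>, \<open>A\<close>, \<open>C\<close>, write
\<open>X - Z = (X - R) - (Z - R)\<close>, a difference of matrices with nonnegative diagonal. Pairing it with
\<open>p - q\<close>, the two mixed terms have a favourable sign, and \<open>resolvent_trace_bound\<close> bounds the other two.\<close>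

lemma resolvent_difference_bound:
  fixes s :: real and a b \<delta> :: "nat \<Rightarrow> real"
  assumes U: "unitary_mat n U" and V: "unitary_mat n V"
    and a: "\<And>i. i < n \<Longrightarrow> 0 \<le> a i" and b: "\<And>i. i < n \<Longrightarrow> 0 \<le> b i" and s: "0 < s"
    and diff: "U * real_diag n a * mat_adjoint U - V * real_diag n b * mat_adjoint V = real_diag n \<delta>"
  shows "s * (\<Sum>i<n. \<delta> i * ((\<Sum>j<n. (cmod (V $$ (i, j)))\<^sup>2 * (1 / (b j + s)))
      - (\<Sum>j<n. (cmod (U $$ (i, j)))\<^sup>2 * (1 / (a j + s)))))
    \<le> (\<Sum>i<n. (\<delta> i)\<^sup>2 / (\<bar>\<delta> i\<bar> + s))"
proof -
  define A where "A = U * real_diag n a * mat_adjoint U"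
  define B where "B = V * real_diag n b * mat_adjoint V"
  define p where "p i = max (\<delta> i) 0" for i
  define q where "q i = max (- \<delta> i) 0" for i
  define C where "C = B + real_diag n p"
  have Uc: "U \<in> carrier_mat n n" and Vc: "V \<in> carrier_mat n n"
    using U V by (auto simp: unitary_mat_def)
  have c [simp]: "A \<in> carrier_mat n n" "B \<in> carrier_mat n n" "C \<in> carrier_mat n n"
    using Uc Vc by (auto simp: A_def B_def C_def)
  have entry: "A $$ (i, j) - B $$ (i, j) = (if i = j then of_real (p i - q i) else 0)" if "i < n" "j < n"
      for i j
    using arg_cong[OF diff[folded A_def B_def], of "\<lambda>Z. Z $$ (i, j)"] that carrier_matD[OF c(2)]
    by (simp add: p_def q_def) (auto simp: max_def)
  have C_eq: "C = A + real_diag n q"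
  proof (rule eq_matI)
    fix i j assume "i < dim_row (A + real_diag n q)" "j < dim_col (A + real_diag n q)"
    then have ij: "i < n" "j < n" by auto
    then show "C $$ (i, j) = (A + real_diag n q) $$ (i, j)"
      using entry[OF ij] carrier_matD[OF c(2)] by (auto simp: C_def algebra_simps)
  qed (use carrier_matD[OF c(3)] in auto)
  have psdB: "psd_mat B" unfolding B_def using Vc b by (rule psd_conj_real_diag)
  have "psd_mat (real_diag n p)" by (rule psd_real_diag) (simp add: p_def)
  then have "psd_mat C" unfolding C_def using psdB by (intro psd_mat_add[of _ n]) auto
  then obtain W w where W: "unitary_mat n W" and CW: "C = W * real_diag n w * mat_adjoint W"
    and w: "\<And>i. i < n \<Longrightarrow> 0 \<le> w i"
    using psd_spectral_decomp[OF c(3)] by blast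
  define X where "X = V * real_diag n (\<lambda>i. 1 / (b i + s)) * mat_adjoint V"
  define Z where "Z = U * real_diag n (\<lambda>i. 1 / (a i + s)) * mat_adjoint U"
  define R where "R = W * real_diag n (\<lambda>i. 1 / (w i + s)) * mat_adjoint W"
  have b': "\<forall>i<n. 0 \<le> b i" and a': "\<forall>i<n. 0 \<le> a i" and w': "\<forall>i<n. 0 \<le> w i"
    using a b w by auto
  note rB = resolvent_properties[OF V b' s, folded B_def X_def]
  note rA = resolvent_properties[OF U a' s, folded A_def Z_def]
  note rC = resolvent_properties[OF W w' s, folded CW R_def]
  have shift: "C + of_real s \<cdot>\<^sub>m 1\<^sub>m n = Y + of_real s \<cdot>\<^sub>m 1\<^sub>m n + real_diag n h"
    if "C = Y + real_diag n h" "Y \<in> carrier_mat n n" for Y h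
    unfolding that(1) using that(2) by (intro eq_matI) auto
  note boundB = resolvent_trace_bound[OF rB(1,2) rC(2) rB(3,4) rC(4) rB(5,6) rC(7)[unfolded shift[OF C_def
      c(2)]] s]
  note boundA = resolvent_trace_bound[OF rA(1,2) rC(2) rA(3,4) rC(4) rA(5,6) rC(7)[unfolded shift[OF C_eq
      c(1)]] s]
  define x where "x i = Re (X $$ (i, i)) - Re (R $$ (i, i))" for i
  define z where "z i = Re (Z $$ (i, i)) - Re (R $$ (i, i))" for i
  have x: "0 \<le> x i" and z: "0 \<le> z i" if "i < n" for i
    using boundB(1)[OF _ that] boundA(1)[OF _ that] by (auto simp: x_def z_def p_def q_def)
  have "s * (\<Sum>i<n. \<delta> i * (x i - z i)) \<le> s * (\<Sum>i<n. p i * x i + q i * z i)"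
  proof (intro mult_left_mono sum_mono)
    fix i assume i: "i \<in> {..<n}"
    have "\<delta> i * x i \<le> p i * x i" and "- \<delta> i * z i \<le> q i * z i"
      using x[of i] z[of i] i by (intro mult_right_mono; simp add: p_def q_def)+
    then show "\<delta> i * (x i - z i) \<le> p i * x i + q i * z i" by (simp add: algebra_simps)
  qed (use s in simp)
  also have "\<dots> = s * (\<Sum>i<n. p i * x i) + s * (\<Sum>i<n. q i * z i)"
    by (simp add: sum.distrib distrib_left)
  also have "\<dots> \<le> (\<Sum>i<n. (p i)\<^sup>2 / (p i + s)) + (\<Sum>i<n. (q i)\<^sup>2 / (q i + s))"
    unfolding x_def z_def by (intro add_mono boundA(2) boundB(2)) (auto simp: p_def q_def)
  also have "\<dots> = (\<Sum>i<n. (\<delta> i)\<^sup>2 / (\<bar>\<delta> i\<bar> + s))"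
    unfolding sum.distrib[symmetric] by (intro sum.cong refl) (auto simp: p_def q_def max_def)
  finally have "s * (\<Sum>i<n. \<delta> i * (x i - z i)) \<le> (\<Sum>i<n. (\<delta> i)\<^sup>2 / (\<bar>\<delta> i\<bar> + s))" .
  moreover have "x i - z i = (\<Sum>j<n. (cmod (V $$ (i, j)))\<^sup>2 * (1 / (b j + s)))
      - (\<Sum>j<n. (cmod (U $$ (i, j)))\<^sup>2 * (1 / (a j + s)))"
    if "i < n" for i
    unfolding x_def z_def X_def Z_def diag_entry_conj_real_diag[OF Uc that] diag_entry_conj_real_diag[OF Vc
        that] by simp
  ultimately show ?thesis by simp
qed

section \<open>Finitely many values of an operator monotone function\<close>

lemma coeff_mult_top:
  assumes "degree p \<le> a" "degree q \<le> b"
  shows "coeff (p * q) (a + b) = coeff p a * coeff q (b :: nat)"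
proof (cases "degree p = a \<and> degree q = b")
  case True
  then show ?thesis using coeff_mult_degree_sum[of p q] by simp
next
  case False
  then have "degree p < a \<or> degree q < b" using assms by auto
  then have "coeff p a * coeff q b = 0" and "degree (p * q) < a + b"
    using degree_mult_le[of p q] assms by (auto simp: coeff_eq_0)
  then show ?thesis by (simp add: coeff_eq_0)
qed

text \<open>Let \<open>e\<close> enumerate the nodes of positive weight and \<open>g\<close> those of negative weight; there are \<open>m\<close> of each.
A polynomial \<open>v\<close> of degree less than \<open>m\<close> is determined by its values on either family. Scaled by the
square roots of the weights, the passage from the first family of values to the second is a matrix
\<open>Q\<close>. It is orthogonal, because the divided difference of \<open>v\<^sup>2\<close>, a polynomial of degree below
\<open>2 * m - 1\<close>, vanishes. The divided difference of \<open>x * v\<^sup>2\<close> is the square of the top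
coefficient of \<open>v\<close>, so the matrix with eigenvalues \<open>g\<close> transported by \<open>Q\<close> exceeds the diagonal
matrix of the \<open>e\<close> by a positive semidefinite matrix of rank at most one. Applying \<open>f\<close> to both and
evaluating the quadratic forms at the vector that represents \<open>v\<close> gives the claim.\<close>

lemma operator_monotone_nodal_even:
  assumes f: "operator_monotone f" and S: "finite S" "\<And>x. x \<in> S \<Longrightarrow> 0 \<le> x"
    and even: "even (card S)" and deg: "2 * degree v + 2 \<le> card S"
  shows "(\<Sum>x\<in>S. f x * (poly v x)\<^sup>2 / nodal S x) \<le> 0"
proof -
  obtain m where m: "card S = 2 * m" using even by (elim evenE)
  with deg have m0: "0 < m" by simp
  define Sp where "Sp = {x\<in>S. 0 < nodal S x}"
  define Sn where "Sn = {x\<in>S. nodal S x < 0}"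
  have split: "S = Sp \<union> Sn" "Sp \<inter> Sn = {}" and fin: "finite Sp" "finite Sn"
    using nodal_nonzero[OF S(1)] S(1) by (auto simp: Sp_def Sn_def linorder_neq_iff)
  have cardp: "card Sp = m" using card_nodal_pos[OF S(1)] m by (simp add: Sp_def)
  then have cardn: "card Sn = m" using card_Un_disjoint[OF fin split(2)] m split(1) by simp
  obtain e where e: "bij_betw e {..<m} Sp"
    using ex_bij_betw_nat_finite[OF fin(1)] cardp by (auto simp: lessThan_atLeast0)
  obtain g where g: "bij_betw g {..<m} Sn"
    using ex_bij_betw_nat_finite[OF fin(2)] cardn by (auto simp: lessThan_atLeast0)
  have eS: "e k \<in> Sp" and gS: "g k \<in> Sn" if "k < m" for k
    using that e g by (auto simp: bij_betw_def)
  have e_inj: "e i = e k \<longleftrightarrow> i = k" if "i < m" "k < m" for i k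
    using that e by (auto simp: bij_betw_def inj_on_def)
  have e0: "0 \<le> e k" and g0: "0 \<le> g k" if "k < m" for k
    using that eS gS S(2) by (auto simp: Sp_def Sn_def)
  define \<sigma> where "\<sigma> k = sqrt (nodal S (e k))" for k
  define \<tau> where "\<tau> k = sqrt (- nodal S (g k))" for k
  have sg: "0 < \<sigma> k" "(\<sigma> k)\<^sup>2 = nodal S (e k)" and tau: "0 < \<tau> k" "(\<tau> k)\<^sup>2 = - nodal S (g k)" if "k < m" for k
    using eS[OF that] gS[OF that] by (auto simp: \<sigma>_def \<tau>_def Sp_def Sn_def)
  have sum_split: "(\<Sum>x\<in>S. h x / nodal S x) = (\<Sum>k<m. h (e k) / (\<sigma> k)\<^sup>2) - (\<Sum>j<m. h (g j) / (\<tau> j)\<^sup>2)"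
      for h :: "real \<Rightarrow> real"
  proof -
    have "(\<Sum>x\<in>S. h x / nodal S x) = (\<Sum>x\<in>Sp. h x / nodal S x) + (\<Sum>x\<in>Sn. h x / nodal S x)"
      using sum.union_disjoint[OF fin split(2), of "\<lambda>x. h x / nodal S x"] split(1) by simp
    also have "(\<Sum>x\<in>Sp. h x / nodal S x) = (\<Sum>k<m. h (e k) / (\<sigma> k)\<^sup>2)"
      by (subst sum.reindex_bij_betw[OF e, symmetric]) (simp add: sg)
    also have "(\<Sum>x\<in>Sn. h x / nodal S x) = - (\<Sum>j<m. h (g j) / (\<tau> j)\<^sup>2)"
      by (subst sum.reindex_bij_betw[OF g, symmetric]) (simp add: tau flip: sum_negf)
    finally show ?thesis by simp
  qed
  define l where "l k = lagrange_basis Sp (e k)" for k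
  have ldeg: "degree (l k) \<le> m - 1" if "k < m" for k
    using degree_lagrange_basis_le[OF fin(1) eS[OF that]] cardp by (simp add: l_def)
  have le: "poly (l k) (e i) = (if i = k then 1 else 0)" if "k < m" "i < m" for i k
    using poly_lagrange_basis[OF fin(1) eS eS, of k i] that e_inj by (simp add: l_def)
  define c where "c k = coeff (l k) (m - 1)" for k
  have gram: "(\<Sum>j<m. poly (l k) (g j) * poly (l i) (g j) / (\<tau> j)\<^sup>2) = (if i = k then 1 / (\<sigma> k)\<^sup>2 else 0)"
    and gram_x: "(\<Sum>j<m. g j * poly (l k) (g j) * poly (l i) (g j) / (\<tau> j)\<^sup>2) = (if i
        = k then e k / (\<sigma> k)\<^sup>2 else 0) + c k * c i"
    if ki: "k < m" "i < m" for k i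
  proof -
    have d: "degree (l k * l i) \<le> 2 * m - 2"
      using degree_mult_le[of "l k" "l i"] ldeg[OF ki(1)] ldeg[OF ki(2)] by linarith
    have top: "coeff (l k * l i) (2 * m - 2) = c k * c i"
      using coeff_mult_top[OF ldeg[OF ki(1)] ldeg[OF ki(2)]] m0 unfolding c_def
      by (metis diff_mult_distrib2 mult_2 nat_mult_1_right)
    have "(\<Sum>x\<in>S. poly (l k * l i) x / nodal S x) = 0"
      using d m m0 by (subst sum_divided_difference[OF S(1) _ even]) (auto intro!: coeff_eq_0)
    then have "(\<Sum>j<m. poly (l k) (g j) * poly (l i) (g j) / (\<tau> j)\<^sup>2)
        = (\<Sum>a<m. poly (l k) (e a) * poly (l i) (e a) / (\<sigma> a)\<^sup>2)"
      unfolding sum_split by simp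
    also have "\<dots> = (\<Sum>a<m. if a = k then (if i = k then 1 / (\<sigma> k)\<^sup>2 else 0) else 0)"
      using ki by (intro sum.cong) (auto simp: le)
    finally show "(\<Sum>j<m. poly (l k) (g j) * poly (l i) (g j) / (\<tau> j)\<^sup>2) = (if i = k then 1 / (\<sigma> k)\<^sup>2 else 0)"
      using ki by simp
    have "degree (pCons 0 (l k * l i)) < card S"
      using d m m0 by (cases "l k * l i = 0") (auto simp: degree_pCons_eq)
    from sum_divided_difference[OF S(1) this even]
    have "(\<Sum>x\<in>S. poly (pCons 0 (l k * l i)) x / nodal S x) = - coeff (pCons 0 (l k * l i)) (Suc (2 * m - 2))"
      using m m0 by (simp add: Suc_diff_Suc numeral_2_eq_2)
    then have "(\<Sum>j<m. g j * poly (l k) (g j) * poly (l i) (g j) / (\<tau> j)\<^sup>2)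
        = (\<Sum>a<m. e a * poly (l k) (e a) * poly (l i) (e a) / (\<sigma> a)\<^sup>2) + c k * c i"
      unfolding sum_split by (simp add: top mult.assoc)
    also have "(\<Sum>a<m. e a * poly (l k) (e a) * poly (l i) (e a) / (\<sigma> a)\<^sup>2) = (\<Sum>a<m. if a = k then (if i
        = k then e k / (\<sigma> k)\<^sup>2 else 0) else 0)"
      using ki by (intro sum.cong) (auto simp: le)
    finally show "(\<Sum>j<m. g j * poly (l k) (g j) * poly (l i) (g j) / (\<tau> j)\<^sup>2) = (if i
        = k then e k / (\<sigma> k)\<^sup>2 else 0) + c k * c i"
      using ki by simp
  qed
  \<comment> \<open>The entries are those of Lagrange interpolation from the nodes \<open>e\<close> to the nodes \<open>g\<close>,
    rescaled by the square roots of the weights.\<close>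
  define Q where "Q = Matrix.mat m m (\<lambda>(j, k). complex_of_real (\<sigma> k * poly (l k) (g j) / \<tau> j))"
  have Q [simp]: "Q \<in> carrier_mat m m" by (simp add: Q_def)
  have Qadj: "mat_adjoint Q \<in> carrier_mat m m" by simp
  have QQ: "(mat_adjoint Q * real_diag m d * Q) $$ (k, i)
      = of_real (\<sigma> k * \<sigma> i * (\<Sum>j<m. d j * poly (l k) (g j) * poly (l i) (g j) / (\<tau> j)\<^sup>2))"
    if "k < m" "i < m" for d k i
  proof -
    have "(mat_adjoint Q * real_diag m d * mat_adjoint (mat_adjoint Q)) $$ (k, i)
        = (\<Sum>j<m. cnj (Q $$ (j, k)) * of_real (d j) * Q $$ (j, i))"
      unfolding index_conj_real_diag[OF Qadj that] using that by (intro sum.cong refl) (simp add: Q_def)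
    also have "\<dots> = of_real (\<sigma> k * \<sigma> i * (\<Sum>j<m. d j * poly (l k) (g j) * poly (l i) (g j) / (\<tau> j)\<^sup>2))"
      unfolding sum_distrib_left of_real_sum using that
      by (intro sum.cong refl) (simp add: Q_def power2_eq_square)
    finally show ?thesis by simp
  qed
  have one: "real_diag m (\<lambda>_. 1) = 1\<^sub>m m" by (rule eq_matI) auto
  have "mat_adjoint Q * Q = mat_adjoint Q * real_diag m (\<lambda>_. 1) * Q"
    unfolding one using Qadj by (simp add: right_mult_one_mat[of _ m m])
  also have "\<dots> = 1\<^sub>m m"
  proof (rule eq_matI)
    fix k i assume "k < dim_row (1\<^sub>m m :: complex mat)" "i < dim_col (1\<^sub>m m :: complex mat)"
    then have ki: "k < m" "i < m" by auto
    have "\<sigma> k * \<sigma> i * (\<Sum>j<m. 1 * poly (l k) (g j) * poly (l i) (g j) / (\<tau> j)\<^sup>2)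
        = \<sigma> k * \<sigma> i * (if i = k then 1 / (\<sigma> k)\<^sup>2 else 0)"
      unfolding mult_1_left gram[OF ki] ..
    also have "\<dots> = (if i = k then 1 else 0)"
      using sg(1)[OF ki(1)] by (simp add: power2_eq_square)
    finally show "(mat_adjoint Q * real_diag m (\<lambda>_. 1) * Q) $$ (k, i) = 1\<^sub>m m $$ (k, i)"
      unfolding QQ[OF ki] using ki by simp
  qed (use carrier_matD[OF Q] in auto)
  finally have "unitary_mat m Q" by (rule unitary_matI[OF Q])
  then have uQ: "unitary_mat m (mat_adjoint Q)" by (rule unitary_mat_adjoint)
  have u1: "unitary_mat m (1\<^sub>m m)" by (simp add: unitary_mat_def)
  define A where "A = real_diag m e"
  define B where "B = mat_adjoint Q * real_diag m g * Q"
  have A_eq: "A = 1\<^sub>m m * real_diag m e * mat_adjoint (1\<^sub>m m)"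
    by (simp add: A_def left_mult_one_mat[of _ m m] right_mult_one_mat[of _ m m])
  have B_eq: "B = mat_adjoint Q * real_diag m g * mat_adjoint (mat_adjoint Q)" by (simp add: B_def)
  have carr: "A \<in> carrier_mat m m" "B \<in> carrier_mat m m"
    using conj_real_diag_closed[OF Qadj, of g] by (auto simp: A_def B_def)
  have psdA: "psd_mat A" unfolding A_def by (rule psd_real_diag) (rule e0)
  have psdB: "psd_mat B" unfolding B_eq by (rule psd_conj_real_diag[OF Qadj]) (rule g0)
  \<comment> \<open>The single column that spans the rank one difference.\<close>
  define N where "N = Matrix.mat m 1 (\<lambda>(k, _). complex_of_real (\<sigma> k * c k))"
  have N: "N \<in> carrier_mat m 1" by (simp add: N_def)
  have "B - A = N * real_diag 1 (\<lambda>_. 1) * mat_adjoint N"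
  proof (rule eq_matI)
    fix k i assume "k < dim_row (N * real_diag 1 (\<lambda>_. 1) * mat_adjoint N)"
        "i < dim_col (N * real_diag 1 (\<lambda>_. 1) * mat_adjoint N)"
    then have ki: "k < m" "i < m" using carrier_matD[OF N] by auto
    have "B $$ (k, i) = of_real (\<sigma> k * \<sigma> i * ((if i = k then e k / (\<sigma> k)\<^sup>2 else 0) + c k * c i))"
      unfolding B_def QQ[OF ki] gram_x[OF ki] ..
    moreover have "\<sigma> k * \<sigma> i * ((if i = k then e k / (\<sigma> k)\<^sup>2 else 0) + c k * c i)
        = (if i = k then e k else 0) + \<sigma> k * c k * (\<sigma> i * c i)"
      using sg(1)[OF ki(1)] by (simp add: power2_eq_square algebra_simps)
    ultimately have "(B - A) $$ (k, i) = of_real (\<sigma> k * c k * (\<sigma> i * c i))"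
      using ki carrier_matD[OF carr(1)] by (auto simp: A_def)
    also have "\<dots> = (N * real_diag 1 (\<lambda>_. 1) * mat_adjoint N) $$ (k, i)"
      unfolding index_conj_real_diag[OF N ki] using ki by (simp add: N_def)
    finally show "(B - A) $$ (k, i) = (N * real_diag 1 (\<lambda>_. 1) * mat_adjoint N) $$ (k, i)" .
  qed (use carrier_matD[OF carr(1)] carrier_matD[OF carr(2)] carrier_matD[OF N] in auto)
  then have "psd_mat (B - A)" using psd_conj_real_diag[OF N, of "\<lambda>_. 1"] by simp
  then have "loewner_le A B" unfolding loewner_le_def using carr by auto
  with f carr psdA psdB have "loewner_le (mat_fun f A) (mat_fun f B)" unfolding operator_monotone_def by blast
  then have "psd_mat (mat_fun f B - mat_fun f A)" by (simp add: loewner_le_def)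
  moreover have fA: "mat_fun f A = real_diag m (\<lambda>i. f (e i))"
    unfolding A_eq mat_fun_conj_real_diag[OF u1]
        by (simp add: left_mult_one_mat[of _ m m] right_mult_one_mat[of _ m m])
  moreover have fB: "mat_fun f B = mat_adjoint Q * real_diag m (\<lambda>i. f (g i)) * Q"
    unfolding B_eq mat_fun_conj_real_diag[OF uQ] by simp
  ultimately have psdf: "psd_mat (mat_adjoint Q * real_diag m (\<lambda>i. f (g i)) * Q
      - real_diag m (\<lambda>i. f (e i)))" by simp
  define x where "x = vec m (\<lambda>k. complex_of_real (poly v (e k) / \<sigma> k))"
  have x: "x \<in> carrier_vec m" by (simp add: x_def)
  have degv: "degree v < card Sp" using deg m cardp by simp
  have Qx: "(Q *\<^sub>v x) $ j = of_real (poly v (g j) / \<tau> j)" if j: "j < m" for j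
  proof -
    have "poly v (g j) = (\<Sum>y\<in>Sp. poly v y * poly (lagrange_basis Sp y) (g j))"
      by (subst lagrange_interpolation[OF fin(1) degv]) (simp add: poly_sum)
    also have "\<dots> = (\<Sum>k<m. poly v (e k) * poly (l k) (g j))"
      by (subst sum.reindex_bij_betw[OF e, symmetric]) (simp add: l_def)
    finally have v_eq: "poly v (g j) = (\<Sum>k<m. poly v (e k) * poly (l k) (g j))" .
    have "(Q *\<^sub>v x) $ j = (\<Sum>k<m. of_real (poly v (e k) * poly (l k) (g j) / \<tau> j))"
      unfolding mult_mat_vec_index_sum[OF Q x j] using j sg(1)[THEN less_imp_neq]
      by (intro sum.cong refl) (force simp: Q_def x_def field_simps)
    also have "\<dots> = of_real (poly v (g j) / \<tau> j)" unfolding v_eq by (simp add: sum_divide_distrib)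
    finally show ?thesis .
  qed
  have fBc: "mat_adjoint Q * real_diag m (\<lambda>i. f (g i)) * Q \<in> carrier_mat m m"
    using conj_real_diag_closed[OF Qadj, of "\<lambda>i. f (g i)"] by simp
  have "0 \<le> ((mat_adjoint Q * real_diag m (\<lambda>i. f (g i)) * Q - real_diag m (\<lambda>i. f (e i))) *\<^sub>v x) \<bullet>c x"
    using psdf x unfolding psd_mat_def by simp
  also have "\<dots> = ((mat_adjoint Q * real_diag m (\<lambda>i. f (g i)) * Q) *\<^sub>v x) \<bullet>c x
      - (real_diag m (\<lambda>i. f (e i)) *\<^sub>v x) \<bullet>c x"
    unfolding minus_mult_distrib_mat_vec[OF fBc real_diag_closed x]
    using x fBc by (intro minus_scalar_prod_distrib[of _ m]) (auto intro: mult_mat_vec_carrier[of _ m m])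
  also have "\<dots> = of_real ((\<Sum>j<m. f (g j) * (cmod ((Q *\<^sub>v x) $ j))\<^sup>2) - (\<Sum>k<m. f (e k) * (cmod (x $ k))\<^sup>2))"
    unfolding conj_quadratic_form[OF Q x] real_diag_quadratic_form[OF x] by simp
  finally have "(\<Sum>k<m. f (e k) * (cmod (x $ k))\<^sup>2) \<le> (\<Sum>j<m. f (g j) * (cmod ((Q *\<^sub>v x) $ j))\<^sup>2)"
    by (simp add: less_eq_complex_def)
  moreover have "(cmod (x $ k))\<^sup>2 = (poly v (e k))\<^sup>2 / (\<sigma> k)\<^sup>2" if "k < m" for k
    using that by (simp add: x_def norm_divide power_divide del: of_real_divide)
  moreover have "(cmod ((Q *\<^sub>v x) $ j))\<^sup>2 = (poly v (g j))\<^sup>2 / (\<tau> j)\<^sup>2" if "j < m" for j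
    unfolding Qx[OF that] by (simp add: power_divide del: of_real_divide)
  ultimately have "(\<Sum>k<m. f (e k) * (poly v (e k))\<^sup>2 / (\<sigma> k)\<^sup>2)
      \<le> (\<Sum>j<m. f (g j) * (poly v (g j))\<^sup>2 / (\<tau> j)\<^sup>2)"
    by simp
  then show ?thesis unfolding sum_split by simp
qed

text \<open>An odd number of nodes is reduced to an even one by adjoining a node \<open>\<mu>\<close> to the right of all others
and multiplying \<open>v\<close> by \<open>\<mu> - x\<close>. This kills the contribution of the new node, so nothing needs to be
known about the growth of \<open>f\<close>; since the weights also gain the factor \<open>\<mu> - x\<close>, only one such factor
remains, and dividing by \<open>\<mu>\<close> and letting it tend to infinity removes it.\<close>

lemma operator_monotone_nodal:
  assumes f: "operator_monotone f" and S: "finite S" "\<And>x. x \<in> S \<Longrightarrow> 0 \<le> x"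
    and deg: "2 * degree v + 2 \<le> card S"
  shows "(\<Sum>x\<in>S. f x * (poly v x)\<^sup>2 / nodal S x) \<le> 0"
proof (cases "even (card S)")
  case True
  then show ?thesis using operator_monotone_nodal_even assms by blast
next
  case False
  define w where "w x = f x * (poly v x)\<^sup>2 / nodal S x" for x
  define M where "M = Max (insert 0 S)"
  have M: "0 \<le> M" "\<And>x. x \<in> S \<Longrightarrow> x \<le> M" using S(1) by (auto simp: M_def)
  have bound: "\<mu> * (\<Sum>x\<in>S. w x) \<le> (\<Sum>x\<in>S. w x * x)" if "M < \<mu>" for \<mu>
  proof -
    have \<mu>: "\<mu> \<notin> S" "0 \<le> \<mu>" using M that by fastforce+
    have deg': "2 * degree (v * [:\<mu>, -1:]) + 2 \<le> card (insert \<mu> S)"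
      using degree_mult_le[of v "[:\<mu>, -1:]"] deg S(1) \<mu> False by (simp del: mult_pCons_right) presburger
    have "(\<Sum>x\<in>insert \<mu> S. f x * (poly (v * [:\<mu>, -1:]) x)\<^sup>2 / nodal (insert \<mu> S) x) \<le> 0"
      using S \<mu> False by (intro operator_monotone_nodal_even[OF f _ _ _ deg']) auto
    also have "(\<Sum>x\<in>insert \<mu> S. f x * (poly (v * [:\<mu>, -1:]) x)\<^sup>2 / nodal (insert \<mu> S) x)
        = (\<Sum>x\<in>S. f x * (poly (v * [:\<mu>, -1:]) x)\<^sup>2 / nodal (insert \<mu> S) x)"
      using S(1) \<mu> by (simp del: mult_pCons_right)
    also have "\<dots> = (\<Sum>x\<in>S. w x * (\<mu> - x))"
    proof (intro sum.cong refl)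
      fix x assume x: "x \<in> S"
      then have "\<mu> - x \<noteq> 0" using \<mu> by auto
      then show "f x * (poly (v * [:\<mu>, -1:]) x)\<^sup>2 / nodal (insert \<mu> S) x = w x * (\<mu> - x)"
        unfolding nodal_insert[OF S(1) \<mu>(1) x] w_def
        by (simp add: power2_eq_square del: mult_pCons_right)
    qed
    finally show ?thesis by (simp add: right_diff_distrib sum_subtractf sum_distrib_left mult.commute)
  qed
  show ?thesis
  proof (rule ccontr)
    define a where "a = (\<Sum>x\<in>S. w x)"
    define b where "b = (\<Sum>x\<in>S. w x * x)"
    assume "\<not> ?thesis"
    then have a: "0 < a" by (simp add: a_def w_def)
    define \<mu> where "\<mu> = max (M + 1) ((b + 1) / a)"
    have "\<mu> * a \<le> b" using bound[of \<mu>] by (simp add: a_def b_def \<mu>_def)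
    moreover have "b + 1 \<le> \<mu> * a" using a by (simp add: \<mu>_def pos_divide_le_eq[symmetric])
    ultimately show False by simp
  qed
qed

lemma sum_mult_sum_list:
  "(\<Sum>x\<in>S. w x * (\<Sum>q\<leftarrow>qs. F q x)) = (\<Sum>q\<leftarrow>qs. \<Sum>x\<in>S. w x * F q x)" for w :: "'a \<Rightarrow> real"
  by (induction qs) (simp_all add: distrib_left sum.distrib)

text \<open>A finite substitute for the integral representation of operator monotone functions: a linear
inequality between values that holds for the functions \<open>x / (x + s)\<close> holds for \<open>f\<close>. Collect the
coefficients at each node \<open>x > 0\<close> into \<open>a x\<close>. Clearing denominators in \<open>\<Sum>x. a x * x / (x + s)\<close> yields
a polynomial \<open>p\<close> in \<open>s\<close> that is nonnegative for \<open>s \<ge> 0\<close> and satisfies \<open>p (-x) = a x * x * nodal S x\<close>.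
Decompose \<open>p\<close> into summands \<open>q\<^sup>2\<close> and \<open>s * r\<^sup>2\<close>. The latter contribute
\<open>- (\<Sum>x. f x * r (-x)\<^sup>2 / nodal S x)\<close> to \<open>\<Sum>x. a x * f x\<close>, and the former the same expression over the nodes
enlarged by 0, a node at which \<open>f\<close> vanishes; both are nonnegative by \<open>operator_monotone_nodal\<close>.\<close>

theorem operator_monotone_resolvent_test:
  fixes c y :: "'k \<Rightarrow> real"
  assumes f: "operator_monotone f" and f0: "f 0 = 0" and K: "finite K" "\<And>k. k \<in> K \<Longrightarrow> 0 \<le> y k"
    and test: "\<And>s. 0 < s \<Longrightarrow> 0 \<le> (\<Sum>k\<in>K. c k * (y k / (y k + s)))"
  shows "0 \<le> (\<Sum>k\<in>K. c k * f (y k))"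
proof -
  define S where "S = y ` K - {0}"
  have S: "finite S" "\<And>x. x \<in> S \<Longrightarrow> 0 < x" using K by (force simp: S_def)+
  define a where "a x = (\<Sum>k\<in>{k\<in>K. y k = x}. c k)" for x
  have regroup: "(\<Sum>k\<in>K. c k * h (y k)) = (\<Sum>x\<in>S. a x * h x)" if "h 0 = 0" for h :: "real \<Rightarrow> real"
  proof -
    have "(\<Sum>k\<in>K. c k * h (y k)) = (\<Sum>x\<in>y ` K. \<Sum>k\<in>{k\<in>K. y k = x}. c k * h (y k))"
      using sum.image_gen[OF K(1), of "\<lambda>k. c k * h (y k)" y] by simp
    also have "\<dots> = (\<Sum>x\<in>y ` K. a x * h x)"
      unfolding a_def sum_distrib_right by (intro sum.cong refl) auto
    also have "\<dots> = (\<Sum>x\<in>S. a x * h x)"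
      using K(1) that by (intro sum.mono_neutral_right) (auto simp: S_def)
    finally show ?thesis .
  qed
  show ?thesis
  proof (cases "S = {}")
    case True
    then show ?thesis using regroup[of f] f0 by simp
  next
    case False
    then have card: "0 < card S" using S(1) by (simp add: card_gt_0_iff)
    define p where "p = (\<Sum>x\<in>S. Polynomial.smult (a x * x) (\<Prod>y\<in>S - {x}. [:y, 1:]))"
    have pos: "0 \<le> poly p t" if t: "0 < t" for t
    proof -
      have "poly p t = (\<Sum>x\<in>S. (\<Prod>y\<in>S. y + t) * (a x * (x / (x + t))))"
        unfolding p_def poly_sum
      proof (intro sum.cong refl)
        fix x assume x: "x \<in> S"
        have "(\<Prod>y\<in>S. y + t) = (x + t) * (\<Prod>y\<in>S - {x}. y + t)" using S(1) x by (rule prod.remove)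
        moreover have "x + t \<noteq> 0" using S(2)[OF x] t by simp
        ultimately show "poly (Polynomial.smult (a x * x) (\<Prod>y\<in>S - {x}. [:y, 1:])) t
            = (\<Prod>y\<in>S. y + t) * (a x * (x / (x + t)))"
          by (simp add: poly_prod)
      qed
      also have "\<dots> = (\<Prod>y\<in>S. y + t) * (\<Sum>k\<in>K. c k * (y k / (y k + t)))"
        using regroup[of "\<lambda>x. x / (x + t)"] by (simp add: sum_distrib_left)
      also have "0 \<le> \<dots>"
        using S(2) t by (intro mult_nonneg_nonneg test prod_nonneg) (auto intro: add_nonneg_nonneg
            less_imp_le)
      finally show ?thesis .
    qed
    have nonneg: "0 \<le> poly p t" if "0 \<le> t" for t
      using pos[of t] poly_nonneg_right_limit[of 0 1 p] pos that by (cases "t = 0") auto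
    have degp: "degree p \<le> card S - 1"
      unfolding p_def
    proof (rule degree_sum_le[OF S(1)])
      fix x assume "x \<in> S"
      then show "degree (Polynomial.smult (a x * x) (\<Prod>y\<in>S - {x}. [:y, 1:])) \<le> card S - 1"
        using S(1) by (intro order.trans[OF degree_smult_le]) (simp add: degree_prod_sum_eq)
    qed
    have p_at: "poly p (- x) = a x * x * nodal S x" if x: "x \<in> S" for x
    proof -
      have "poly p (- x) = (\<Sum>z\<in>S. if z = x then a x * x * nodal S x else 0)"
        unfolding p_def poly_sum
      proof (intro sum.cong refl)
        fix z assume "z \<in> S"
        show "poly (Polynomial.smult (a z * z) (\<Prod>y\<in>S - {z}. [:y, 1:])) (- x) = (if z
            = x then a x * x * nodal S x else 0)"
        proof (cases "z = x")
          case False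
          then have "(\<Prod>y\<in>S - {z}. y - x) = 0" using S(1) x by (intro prod_zero) auto
          with False show ?thesis by (simp add: poly_prod)
        qed (simp add: poly_prod nodal_def)
      qed
      then show ?thesis using S(1) x by simp
    qed
    obtain qs rs where dec: "p = (\<Sum>q\<leftarrow>qs. q * q) + [:0, 1:] * (\<Sum>r\<leftarrow>rs. r * r)"
      and qs: "\<forall>q\<in>set qs. 2 * degree q \<le> degree p" and rs: "\<forall>r\<in>set rs. 2 * degree r + 1 \<le> degree p"
      using poly_nonneg_halfline_sos[OF nonneg] by blast
    have poly_sq: "poly (\<Sum>q\<leftarrow>qs. q * q) x = (\<Sum>q\<leftarrow>qs. (poly q x)\<^sup>2)" for qs :: "real poly list" and x
      by (induction qs) (simp_all add: power2_eq_square)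
    have node_eq: "a x * f x = f x / (x * nodal S x) * (\<Sum>q\<leftarrow>qs. (poly q (- x))\<^sup>2)
        - f x / nodal S x * (\<Sum>r\<leftarrow>rs. (poly r (- x))\<^sup>2)"
      if x: "x \<in> S" for x
    proof -
      have "a x * x * nodal S x = (\<Sum>q\<leftarrow>qs. (poly q (- x))\<^sup>2) - x * (\<Sum>r\<leftarrow>rs. (poly r (- x))\<^sup>2)"
        unfolding p_at[OF x, symmetric] by (subst dec) (simp add: poly_sq)
      then have "a x = ((\<Sum>q\<leftarrow>qs. (poly q (- x))\<^sup>2) - x * (\<Sum>r\<leftarrow>rs. (poly r (- x))\<^sup>2)) / (x * nodal S x)"
        using S(2)[OF x] nodal_nonzero[OF S(1), of x] by (simp add: field_simps)
      moreover have "(Q - x * R) / (x * nodal S x) * f x = f x / (x * nodal S x) * Q - f x / nodal S x * R"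
          for Q R
        using S(2)[OF x] nodal_nonzero[OF S(1), of x] by (simp add: field_simps)
      ultimately show ?thesis by simp
    qed
    have q_part: "0 \<le> (\<Sum>x\<in>S. f x / (x * nodal S x) * (poly q (- x))\<^sup>2)" if q: "q \<in> set qs" for q
    proof -
      have 0: "0 \<notin> S" by (simp add: S_def)
      define v where "v = pcompose q [:0, -1:]"
      have "2 * degree v + 2 \<le> card (insert 0 S)"
        using bspec[OF qs q] degp card 0 S(1) by (simp add: v_def degree_pcompose)
      from operator_monotone_nodal[OF f _ _ this] S
      have "(\<Sum>x\<in>insert 0 S. f x * (poly v x)\<^sup>2 / nodal (insert 0 S) x) \<le> 0" by (auto intro: less_imp_le)
      also have "(\<Sum>x\<in>insert 0 S. f x * (poly v x)\<^sup>2 / nodal (insert 0 S) x)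
          = (\<Sum>x\<in>S. - (f x / (x * nodal S x) * (poly q (- x))\<^sup>2))"
        using S(1) 0 f0 by (simp add: nodal_insert[OF S(1) 0] v_def poly_pcompose)
      finally show ?thesis by (simp add: sum_negf)
    qed
    have r_part: "(\<Sum>x\<in>S. f x / nodal S x * (poly r (- x))\<^sup>2) \<le> 0" if r: "r \<in> set rs" for r
    proof -
      define v where "v = pcompose r [:0, -1:]"
      have "2 * degree v + 2 \<le> card S"
        using bspec[OF rs r] degp card by (simp add: v_def degree_pcompose)
      from operator_monotone_nodal[OF f _ _ this] S show ?thesis
        by (simp add: v_def poly_pcompose less_imp_le)
    qed
    have "(\<Sum>k\<in>K. c k * f (y k)) = (\<Sum>x\<in>S. f x / (x * nodal S x) * (\<Sum>q\<leftarrow>qs. (poly q (- x))\<^sup>2))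
        - (\<Sum>x\<in>S. f x / nodal S x * (\<Sum>r\<leftarrow>rs. (poly r (- x))\<^sup>2))"
      unfolding regroup[of f, OF f0] sum_subtractf[symmetric] by (intro sum.cong refl node_eq)
    also have "\<dots> = (\<Sum>q\<leftarrow>qs. \<Sum>x\<in>S. f x / (x * nodal S x) * (poly q (- x))\<^sup>2)
        - (\<Sum>r\<leftarrow>rs. \<Sum>x\<in>S. f x / nodal S x * (poly r (- x))\<^sup>2)"
      unfolding sum_mult_sum_list ..
    also have "0 \<le> \<dots>"
    proof -
      have "0 \<le> (\<Sum>q\<leftarrow>qs. \<Sum>x\<in>S. f x / (x * nodal S x) * (poly q (- x))\<^sup>2)"
        using q_part by (intro sum_list_nonneg) auto
      moreover have "(\<Sum>r\<leftarrow>rs. \<Sum>x\<in>S. f x / nodal S x * (poly r (- x))\<^sup>2) \<le> 0"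
        using r_part by (intro sum_list_nonpos) auto
      ultimately show ?thesis by simp
    qed
    finally show ?thesis .
  qed
qed

section \<open>The trace inequality for operator monotone functions\<close>

theorem theorem2p1:
  fixes f :: "real \<Rightarrow> real" and n :: nat and A B :: "complex mat"
  assumes "\<And>x. 0 \<le> x \<Longrightarrow> 0 \<le> f x"
    and "operator_monotone f"
    and "f 0 = 0"
    and "A \<in> carrier_mat n n" and "B \<in> carrier_mat n n"
    and "psd_mat A" and "psd_mat B"
  shows "mat_trace ((A - B) * (mat_fun f A - mat_fun f B))
           \<le> mat_trace (mat_abs (A - B) * mat_fun f (mat_abs (A - B)))"
proof -
  note c = assms(4,5)
  obtain U a where U: "unitary_mat n U" and A: "A = U * real_diag n a * mat_adjoint U"
    and a: "\<And>i. i < n \<Longrightarrow> 0 \<le> a i"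
    using psd_spectral_decomp[OF c(1) assms(6)] by blast
  obtain V b where V: "unitary_mat n V" and B: "B = V * real_diag n b * mat_adjoint V"
    and b: "\<And>i. i < n \<Longrightarrow> 0 \<le> b i"
    using psd_spectral_decomp[OF c(2) assms(7)] by blast
  have "hermitian_mat (A - B)"
    using assms by (simp add: psd_mat_def hermitian_mat_def mat_adjoint_minus[of _ n n])
  moreover have "A - B \<in> carrier_mat n n" using c by auto
  ultimately obtain Z \<delta> where Z: "unitary_mat n Z" and D: "A - B = Z * real_diag n \<delta> * mat_adjoint Z"
    using hermitian_spectral_decomp by blast
  have Zc: "Z \<in> carrier_mat n n" "mat_adjoint Z \<in> carrier_mat n n" and ZZ: "mat_adjoint Z * Z = 1\<^sub>m n"
    and Uc: "U \<in> carrier_mat n n" "mat_adjoint U \<in> carrier_mat n n"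
    and Vc: "V \<in> carrier_mat n n" "mat_adjoint V \<in> carrier_mat n n"
    using Z U V by (auto simp: unitary_mat_def)
  define U' where "U' = mat_adjoint Z * U"
  define V' where "V' = mat_adjoint Z * V"
  have U': "unitary_mat n U'" and V': "unitary_mat n V'"
    unfolding U'_def V'_def by (intro unitary_mat_mult unitary_mat_adjoint Z U V)+
  \<comment> \<open>From here on everything is expressed in the eigenbasis \<open>Z\<close> of \<open>A - B\<close>.\<close>
  have rotated: "U' * real_diag n a * mat_adjoint U' - V' * real_diag n b * mat_adjoint V' = real_diag n \<delta>"
  proof -
    note [simp] = assoc_mult_mat[of _ n n _ n _ n] mult_carrier_mat[of _ n n _ n]
    have "U' * real_diag n a * mat_adjoint U' = mat_adjoint Z * (A * Z)"
      unfolding U'_def A mat_adjoint_mult[OF Zc(2) Uc(1)] using Zc Uc by simp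
    moreover have "V' * real_diag n b * mat_adjoint V' = mat_adjoint Z * (B * Z)"
      unfolding V'_def B mat_adjoint_mult[OF Zc(2) Vc(1)] using Zc Vc by simp
    moreover have "mat_adjoint Z * (A * Z) - mat_adjoint Z * (B * Z) = mat_adjoint Z * ((A - B) * Z)"
      using c Zc by (simp add: minus_mult_distrib_mat[of _ n n _ _ n] mult_minus_distrib_mat[of _ n n _ n])
    moreover have "mat_adjoint Z * ((A - B) * Z)
        = (mat_adjoint Z * Z) * (real_diag n \<delta> * (mat_adjoint Z * Z))"
      unfolding D using Zc by simp
    ultimately show ?thesis
      unfolding ZZ by (simp add: left_mult_one_mat[of _ n n] right_mult_one_mat[of _ n n])
  qed
  \<comment> \<open>\<open>x h\<close> and \<open>y h\<close> are the diagonals of \<open>h(A)\<close> and \<open>h(B)\<close> in that basis, so that \<open>\<Phi> h\<close> is the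
    right-hand side of the inequality for \<open>h\<close> minus the left-hand side. It is linear in the values of \<open>h\<close>
    at the eigenvalues of \<open>|A - B|\<close>, \<open>A\<close> and \<open>B\<close>, which the three summands of \<open>K\<close> index in this order.\<close>
  define x where "x h i = (\<Sum>j<n. (cmod (U' $$ (i, j)))\<^sup>2 * h (a j))" for h :: "real \<Rightarrow> real" and i
  define y where "y h i = (\<Sum>j<n. (cmod (V' $$ (i, j)))\<^sup>2 * h (b j))" for h :: "real \<Rightarrow> real" and i
  define \<Phi> where "\<Phi> h = (\<Sum>i<n. \<bar>\<delta> i\<bar> * h \<bar>\<delta> i\<bar>) - (\<Sum>i<n. \<delta> i * (x h i - y h i))" for h
  define coef where "coef = case_sum (\<lambda>i. \<bar>\<delta> i\<bar>)
    (case_sum (\<lambda>j. - (\<Sum>i<n. \<delta> i * (cmod (U' $$ (i, j)))\<^sup>2)) (\<lambda>j. \<Sum>i<n. \<delta> i * (cmod (V' $$ (i, j)))\<^sup>2))"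
  define node where "node = case_sum (\<lambda>i. \<bar>\<delta> i\<bar>) (case_sum a b)"
  define K where "K = {..<n} <+> ({..<n} <+> {..<n})"
  have \<Phi>_eq: "\<Phi> h = (\<Sum>k\<in>K. coef k * h (node k))" for h
  proof -
    have "(\<Sum>j<n. (\<Sum>i<n. \<delta> i * (cmod (W $$ (i, j)))\<^sup>2) * h (d j))
        = (\<Sum>i<n. \<delta> i * (\<Sum>j<n. (cmod (W $$ (i, j)))\<^sup>2 * h (d j)))"
      for W and d :: "nat \<Rightarrow> real"
      unfolding sum_distrib_left sum_distrib_right by (subst sum.swap) (simp add: mult.assoc)
    then show ?thesis
      by (simp add: \<Phi>_def K_def coef_def node_def x_def y_def sum.Plus o_def sum_negf right_diff_distrib
          sum_subtractf)
  qed
  have "0 \<le> \<Phi> f"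
    unfolding \<Phi>_eq
  proof (rule operator_monotone_resolvent_test[OF assms(2,3)])
    show "finite K" by (simp add: K_def)
    show "0 \<le> node k" if "k \<in> K" for k using that a b by (auto simp: K_def node_def)
    fix s :: real assume s: "0 < s"
    \<comment> \<open>The rows of a unitary matrix give probability weights, so averaging
      \<open>t / (t + s) = 1 - s * (1 / (t + s))\<close> turns the test functions into resolvents.\<close>
    have average: "(\<Sum>j<n. w j * (d j / (d j + s))) = 1 - s * (\<Sum>j<n. w j * (1 / (d j + s)))"
      if w: "(\<Sum>j<n. w j) = 1" and d: "\<And>j. j < n \<Longrightarrow> 0 \<le> d j" for w d :: "nat \<Rightarrow> real"
    proof -
      have "w j * (d j / (d j + s)) = w j - s * (w j * (1 / (d j + s)))" if "j < n" for j
        using d[OF that] s by (simp add: field_simps)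
      then have "(\<Sum>j<n. w j * (d j / (d j + s))) = (\<Sum>j<n. w j - s * (w j * (1 / (d j + s))))"
        by (intro sum.cong) auto
      then show ?thesis by (simp only: sum_subtractf w sum_distrib_left)
    qed
    have xs: "x (\<lambda>t. t / (t + s)) i = 1 - s * x (\<lambda>t. 1 / (t + s)) i"
      and ys: "y (\<lambda>t. t / (t + s)) i = 1 - s * y (\<lambda>t. 1 / (t + s)) i" if "i < n" for i
      unfolding x_def y_def
      by (rule average[OF unitary_row_sum[OF U' that] a], assumption,
          rule average[OF unitary_row_sum[OF V' that] b], assumption)
    have "(\<Sum>i<n. \<delta> i * (x (\<lambda>t. t / (t + s)) i - y (\<lambda>t. t / (t + s)) i))
        = s * (\<Sum>i<n. \<delta> i * (y (\<lambda>t. 1 / (t + s)) i - x (\<lambda>t. 1 / (t + s)) i))"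
      unfolding sum_distrib_left by (intro sum.cong refl) (simp add: xs ys algebra_simps)
    also have "\<dots> \<le> (\<Sum>i<n. (\<delta> i)\<^sup>2 / (\<bar>\<delta> i\<bar> + s))"
      unfolding x_def y_def by (rule resolvent_difference_bound[OF U' V' a b s rotated])
    also have "\<dots> = (\<Sum>i<n. \<bar>\<delta> i\<bar> * (\<bar>\<delta> i\<bar> / (\<bar>\<delta> i\<bar> + s)))"
      by (simp add: power2_eq_square)
    finally have "0 \<le> \<Phi> (\<lambda>t. t / (t + s))" by (simp add: \<Phi>_def)
    then show "0 \<le> (\<Sum>k\<in>K. coef k * (node k / (node k + s)))" unfolding \<Phi>_eq .
  qed
  have fA: "mat_fun f A = U * real_diag n (\<lambda>i. f (a i)) * mat_adjoint U"
    and fB: "mat_fun f B = V * real_diag n (\<lambda>i. f (b i)) * mat_adjoint V"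
    unfolding A B by (rule mat_fun_conj_real_diag[OF U], rule mat_fun_conj_real_diag[OF V])
  have fc: "mat_fun f A \<in> carrier_mat n n" "mat_fun f B \<in> carrier_mat n n"
    unfolding fA fB using conj_real_diag_closed[OF Uc(1)] conj_real_diag_closed[OF Vc(1)] by blast+
  have Dc: "A - B \<in> carrier_mat n n" using c by auto
  have "mat_trace ((A - B) * (mat_fun f A - mat_fun f B))
      = mat_trace ((A - B) * mat_fun f A) - mat_trace ((A - B) * mat_fun f B)"
    unfolding mult_minus_distrib_mat[OF Dc fc] using Dc fc by (intro mat_trace_minus[of _ n]) auto
  also have "\<dots> = of_real (\<Sum>i<n. \<delta> i * (x f i - y f i))"
    unfolding D fA fB trace_mult_conj_real_diag[OF Z U] trace_mult_conj_real_diag[OF Z V]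
    by (simp add: x_def y_def U'_def V'_def right_diff_distrib sum_subtractf)
  finally have lhs: "mat_trace ((A - B) * (mat_fun f A - mat_fun f B))
      = of_real (\<Sum>i<n. \<delta> i * (x f i - y f i))" .
  have rhs: "mat_trace (mat_abs (A - B) * mat_fun f (mat_abs (A - B))) = of_real (\<Sum>i<n. \<bar>\<delta> i\<bar> * f \<bar>\<delta> i\<bar>)"
    unfolding D mat_abs_conj_real_diag[OF Z] mat_fun_conj_real_diag[OF Z] conj_real_diag_mult[OF Z]
    by (rule trace_conj_real_diag[OF Z])
  show ?thesis
    unfolding lhs rhs using \<open>0 \<le> \<Phi> f\<close> by (simp add: \<Phi>_def less_eq_complex_def)
qed

end
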